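(* Let $\mathcal A$ be an abelian category, $K(\mathcal A)$ a quotient of the Grothendieck group $K_0(\mathcal A)$ by a fixed subgroup, and $(\tau,T,\le)$ a weak stability condition on $\mathcal A$. Suppose $\mathcal A$ is noetherian and $\tau$-artinian. Then each $X\in\mathcal A$ admits a unique filtration by subobjects $0=A_0\subset A_1\subset\cdots\subset A_n=X$ for some $n\ge 0$, such that $S_k=A_k/A_{k-1}$ is $\tau$-semistable for $k=1,\dots,n$, and $\tau([S_1])>\tau([S_2])>\cdots>\tau([S_n])$.
   Context: Let $C(\mathcal A)=\{[X]\in K(\mathcal A): X\in\mathcal A,\ X\not\cong 0\}$; it is assumed (as in the paper) that $[X]=0$ in $K(\mathcal A)$ implies $X\cong 0$. A weak stability condition $(\tau,T,\le)$ on $\mathcal A$ consists of a totally ordered set $(T,\le)$ and a map $\tau:C(\mathcal A)\to T$ such that whenever $\alpha,\beta,\gamma\in C(\mathcal A)$ with $\beta=\alpha+\gamma$, either $\tau(\alpha)\le\tau(\beta)\le\tau(\gamma)$ or $\tau(\alpha)\ge\tau(\beta)\ge\tau(\gamma)$. A nonzero object $X\in\mathcal A$ is $\tau$-semistable if for all subobjects $S\subset X$ with $S\ne 0,X$ we have $\tau([S])\le\tau([X/S])$. $\mathcal A$ is noetherian if all ascending chains of subobjects $A_1\subset A_2\subset\cdots\subset X$ stabilize. $\mathcal A$ is $\tau$-artinian if there is no infinite chain of subobjects $\cdots\subset A_2\subset A_1\subset X$ in $\mathcal A$ with $A_{n+1}\ne A_n$ and $\tau([A_{n+1}])\ge\tau([A_n/A_{n+1}])$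 for all $n$. *)

theory Defs
  imports "HOL-Algebra.Free_Abelian_Groups"
begin

section \<open>Abelian categories\<close>

text \<open>
  Composition and addition are total functions whose values matter only on composable,
  respectively parallel, arrows. Composition is written in the order of functions:
  \<open>g \<cdot> f\<close> is \<open>f\<close> followed by \<open>g\<close>.
\<close>

record ('o, 'm) add_cat =
  Obj  :: "'o set"
  Arr  :: "'m set"
  Dom  :: "'m \<Rightarrow> 'o"
  Cod  :: "'m \<Rightarrow> 'o"
  Ident :: "'o \<Rightarrow> 'm"
  Comp :: "'m \<Rightarrow> 'm \<Rightarrow> 'm"  (infixl \<open>\<cdot>\<index>\<close> 70)
  Plus :: "'m \<Rightarrow> 'm \<Rightarrow> 'm"
  Zero :: "'o \<Rightarrow> 'o \<Rightarrow> 'm"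

definition Hom :: "('o, 'm, 'z) add_cat_scheme \<Rightarrow> 'o \<Rightarrow> 'o \<Rightarrow> 'm set" where
  "Hom C X Y = {f \<in> Arr C. Dom C f = X \<and> Cod C f = Y}"

definition Hom_group :: "('o, 'm, 'z) add_cat_scheme \<Rightarrow> 'o \<Rightarrow> 'o \<Rightarrow> 'm monoid" where
  "Hom_group C X Y = \<lparr>carrier = Hom C X Y, mult = Plus C, one = Zero C X Y\<rparr>"

locale category =
  fixes C :: "('o, 'm, 'z) add_cat_scheme" (structure)
  assumes Dom_Obj: "f \<in> Arr C \<Longrightarrow> Dom C f \<in> Obj C"
    and Cod_Obj: "f \<in> Arr C \<Longrightarrow> Cod C f \<in> Obj C"
    and Ident_Hom: "X \<in> Obj C \<Longrightarrow> Ident C X \<in> Hom C X X"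
    and Comp_Hom: "\<lbrakk>f \<in> Hom C X Y; g \<in> Hom C Y Z\<rbrakk> \<Longrightarrow> g \<cdot> f \<in> Hom C X Z"
    and Comp_assoc:
      "\<lbrakk>f \<in> Hom C W X; g \<in> Hom C X Y; h \<in> Hom C Y Z\<rbrakk> \<Longrightarrow> (h \<cdot> g) \<cdot> f = h \<cdot> (g \<cdot> f)"
    and Comp_Ident_right: "f \<in> Hom C X Y \<Longrightarrow> f \<cdot> Ident C X = f"
    and Comp_Ident_left: "f \<in> Hom C X Y \<Longrightarrow> Ident C Y \<cdot> f = f"

locale preadditive_category = category +
  assumes Hom_comm_group: "\<lbrakk>X \<in> Obj C; Y \<in> Obj C\<rbrakk> \<Longrightarrow> comm_group (Hom_group C X Y)"
    and Comp_Plus_left: "\<lbrakk>f \<in> Hom C X Y; g \<in> Hom C Y Z; h \<in> Hom C Y Z\<rbrakk>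
      \<Longrightarrow> Plus C g h \<cdot> f = Plus C (g \<cdot> f) (h \<cdot> f)"
    and Comp_Plus_right: "\<lbrakk>f \<in> Hom C X Y; g \<in> Hom C X Y; h \<in> Hom C Y Z\<rbrakk>
      \<Longrightarrow> h \<cdot> Plus C f g = Plus C (h \<cdot> f) (h \<cdot> g)"

definition is_zero_object :: "('o, 'm, 'z) add_cat_scheme \<Rightarrow> 'o \<Rightarrow> bool" where
  "is_zero_object C Z \<longleftrightarrow> Z \<in> Obj C \<and>
     (\<forall>X\<in>Obj C. (\<exists>!f. f \<in> Hom C X Z) \<and> (\<exists>!f. f \<in> Hom C Z X))"

definition is_biproduct ::
    "('o, 'm, 'z) add_cat_scheme \<Rightarrow> 'o \<Rightarrow> 'o \<Rightarrow> 'o \<Rightarrow> 'm \<Rightarrow> 'm \<Rightarrow> 'm \<Rightarrow> 'm \<Rightarrow> bool" where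
  "is_biproduct C X Y Z i j p q \<longleftrightarrow>
     i \<in> Hom C X Z \<and> j \<in> Hom C Y Z \<and> p \<in> Hom C Z X \<and> q \<in> Hom C Z Y \<and>
     p \<cdot>\<^bsub>C\<^esub> i = Ident C X \<and> q \<cdot>\<^bsub>C\<^esub> j = Ident C Y \<and>
     p \<cdot>\<^bsub>C\<^esub> j = Zero C Y X \<and> q \<cdot>\<^bsub>C\<^esub> i = Zero C X Y \<and>
     Plus C (i \<cdot>\<^bsub>C\<^esub> p) (j \<cdot>\<^bsub>C\<^esub> q) = Ident C Z"

definition is_mono :: "('o, 'm, 'z) add_cat_scheme \<Rightarrow> 'm \<Rightarrow> bool" where
  "is_mono C f \<longleftrightarrow> f \<in> Arr C \<and>
     (\<forall>W\<in>Obj C. \<forall>g\<in>Hom C W (Dom C f). \<forall>h\<in>Hom C W (Dom C f).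
        f \<cdot>\<^bsub>C\<^esub> g = f \<cdot>\<^bsub>C\<^esub> h \<longrightarrow> g = h)"

definition is_epi :: "('o, 'm, 'z) add_cat_scheme \<Rightarrow> 'm \<Rightarrow> bool" where
  "is_epi C f \<longleftrightarrow> f \<in> Arr C \<and>
     (\<forall>W\<in>Obj C. \<forall>g\<in>Hom C (Cod C f) W. \<forall>h\<in>Hom C (Cod C f) W.
        g \<cdot>\<^bsub>C\<^esub> f = h \<cdot>\<^bsub>C\<^esub> f \<longrightarrow> g = h)"

definition is_iso :: "('o, 'm, 'z) add_cat_scheme \<Rightarrow> 'm \<Rightarrow> bool" where
  "is_iso C f \<longleftrightarrow> f \<in> Arr C \<and>
     (\<exists>g\<in>Hom C (Cod C f) (Dom C f).
        g \<cdot>\<^bsub>C\<^esub> f = Ident C (Dom C f) \<and> f \<cdot>\<^bsub>C\<^esub> g = Ident C (Cod C f))"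

definition is_kernel :: "('o, 'm, 'z) add_cat_scheme \<Rightarrow> 'm \<Rightarrow> 'm \<Rightarrow> bool" where
  \<comment> \<open>\<open>k\<close> is a kernel of \<open>f\<close>\<close>
  "is_kernel C f k \<longleftrightarrow> f \<in> Arr C \<and> k \<in> Arr C \<and> Cod C k = Dom C f \<and>
     f \<cdot>\<^bsub>C\<^esub> k = Zero C (Dom C k) (Cod C f) \<and>
     (\<forall>W\<in>Obj C. \<forall>g\<in>Hom C W (Dom C f). f \<cdot>\<^bsub>C\<^esub> g = Zero C W (Cod C f) \<longrightarrow>
        (\<exists>!u. u \<in> Hom C W (Dom C k) \<and> k \<cdot>\<^bsub>C\<^esub> u = g))"

definition is_cokernel :: "('o, 'm, 'z) add_cat_scheme \<Rightarrow> 'm \<Rightarrow> 'm \<Rightarrow> bool" where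
  \<comment> \<open>\<open>c\<close> is a cokernel of \<open>f\<close>\<close>
  "is_cokernel C f c \<longleftrightarrow> f \<in> Arr C \<and> c \<in> Arr C \<and> Dom C c = Cod C f \<and>
     c \<cdot>\<^bsub>C\<^esub> f = Zero C (Dom C f) (Cod C c) \<and>
     (\<forall>W\<in>Obj C. \<forall>g\<in>Hom C (Cod C f) W. g \<cdot>\<^bsub>C\<^esub> f = Zero C (Dom C f) W \<longrightarrow>
        (\<exists>!u. u \<in> Hom C (Cod C c) W \<and> u \<cdot>\<^bsub>C\<^esub> c = g))"

locale abelian_category = preadditive_category +
  assumes zero_object: "\<exists>Z. is_zero_object C Z"
    and biproducts: "\<lbrakk>X \<in> Obj C; Y \<in> Obj C\<rbrakk> \<Longrightarrow> \<exists>Z\<in>Obj C. \<exists>i j p q. is_biproduct C X Y Z i j p q"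
    and kernels: "f \<in> Arr C \<Longrightarrow> \<exists>k. is_kernel C f k"
    and cokernels: "f \<in> Arr C \<Longrightarrow> \<exists>c. is_cokernel C f c"
    and mono_normal: "is_mono C f \<Longrightarrow> \<exists>g. is_kernel C g f"
    and epi_normal: "is_epi C f \<Longrightarrow> \<exists>g. is_cokernel C g f"

definition short_exact :: "('o, 'm, 'z) add_cat_scheme \<Rightarrow> 'm \<Rightarrow> 'm \<Rightarrow> bool" where
  "short_exact C f g \<longleftrightarrow> is_kernel C g f \<and> is_cokernel C f g"


section \<open>Subobjects and quotients\<close>

text \<open>
  A subobject of \<open>X\<close> is an equivalence class of monomorphisms into \<open>X\<close>, two of them being
  equivalent if they differ by an isomorphism of their domains.
\<close>

definition subobject_of :: "('o, 'm, 'z) add_cat_scheme \<Rightarrow> 'm \<Rightarrow> 'm set" where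
  "subobject_of C i = {j. is_mono C j \<and> Cod C j = Cod C i \<and>
     (\<exists>h\<in>Hom C (Dom C j) (Dom C i). is_iso C h \<and> j = i \<cdot>\<^bsub>C\<^esub> h)}"

definition subobjects :: "('o, 'm, 'z) add_cat_scheme \<Rightarrow> 'o \<Rightarrow> 'm set set" where
  "subobjects C X = {subobject_of C i | i. is_mono C i \<and> Cod C i = X}"

definition subobject_le :: "('o, 'm, 'z) add_cat_scheme \<Rightarrow> 'm set \<Rightarrow> 'm set \<Rightarrow> bool" where
  "subobject_le C S T \<longleftrightarrow>
     (\<exists>s\<in>S. \<exists>t\<in>T. \<exists>f\<in>Hom C (Dom C s) (Dom C t). s = t \<cdot>\<^bsub>C\<^esub> f)"

definition zero_subobject :: "('o, 'm, 'z) add_cat_scheme \<Rightarrow> 'o \<Rightarrow> 'm set" where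
  "zero_subobject C X = {i. is_mono C i \<and> Cod C i = X \<and> is_zero_object C (Dom C i)}"

definition whole_subobject :: "('o, 'm, 'z) add_cat_scheme \<Rightarrow> 'o \<Rightarrow> 'm set" where
  "whole_subobject C X = subobject_of C (Ident C X)"

text \<open>
  The object underlying a subobject and the quotient \<open>T / S\<close> of two subobjects \<open>S \<le> T\<close> of
  the same object are determined only up to isomorphism; both are fixed by choice. They are
  used only through their classes in \<open>K\<close> and through semistability, which are invariant
  under isomorphism.
\<close>

definition subobject_dom :: "('o, 'm, 'z) add_cat_scheme \<Rightarrow> 'm set \<Rightarrow> 'o" where
  "subobject_dom C S = Dom C (SOME s. s \<in> S)"

definition subquotient :: "('o, 'm, 'z) add_cat_scheme \<Rightarrow> 'm set \<Rightarrow> 'm set \<Rightarrow> 'o" where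
  \<comment> \<open>\<open>subquotient C T S\<close> is \<open>T / S\<close>\<close>
  "subquotient C T S = (SOME Q. \<exists>s\<in>S. \<exists>t\<in>T. \<exists>f\<in>Hom C (Dom C s) (Dom C t). \<exists>c.
     s = t \<cdot>\<^bsub>C\<^esub> f \<and> is_cokernel C f c \<and> Q = Cod C c)"

definition noetherian_category :: "('o, 'm, 'z) add_cat_scheme \<Rightarrow> bool" where
  "noetherian_category C \<longleftrightarrow> (\<forall>X\<in>Obj C. \<forall>A :: nat \<Rightarrow> 'm set.
     (\<forall>n. A n \<in> subobjects C X \<and> subobject_le C (A n) (A (Suc n))) \<longrightarrow>
     (\<exists>N. \<forall>n\<ge>N. A n = A N))"


section \<open>The Grothendieck group and its quotients\<close>

text \<open>The groups below are abelian; HOL-Algebra writes their operation multiplicatively.\<close>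

definition K0_relations :: "('o, 'm, 'z) add_cat_scheme \<Rightarrow> ('o \<Rightarrow>\<^sub>0 int) set" where
  "K0_relations C = generate (free_Abelian_group (Obj C))
     {frag_of (Cod C f) - frag_of (Dom C f) - frag_of (Cod C g) | f g. short_exact C f g}"

definition K0 :: "('o, 'm, 'z) add_cat_scheme \<Rightarrow> ('o \<Rightarrow>\<^sub>0 int) set monoid" where
  "K0 C = free_Abelian_group (Obj C) Mod K0_relations C"

definition K0_class :: "('o, 'm, 'z) add_cat_scheme \<Rightarrow> 'o \<Rightarrow> ('o \<Rightarrow>\<^sub>0 int) set" where
  "K0_class C X = K0_relations C #>\<^bsub>free_Abelian_group (Obj C)\<^esub> frag_of X"

text \<open>In the following, \<open>N\<close> is the subgroup of \<open>K\<^sub>0\<close> by which one divides.\<close>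

definition K_group ::
    "('o, 'm, 'z) add_cat_scheme \<Rightarrow> ('o \<Rightarrow>\<^sub>0 int) set set \<Rightarrow> ('o \<Rightarrow>\<^sub>0 int) set set monoid" where
  "K_group C N = K0 C Mod N"

definition K_class ::
    "('o, 'm, 'z) add_cat_scheme \<Rightarrow> ('o \<Rightarrow>\<^sub>0 int) set set \<Rightarrow> 'o \<Rightarrow> ('o \<Rightarrow>\<^sub>0 int) set set" where
  "K_class C N X = N #>\<^bsub>K0 C\<^esub> K0_class C X"

definition positive_cone ::
    "('o, 'm, 'z) add_cat_scheme \<Rightarrow> ('o \<Rightarrow>\<^sub>0 int) set set \<Rightarrow> ('o \<Rightarrow>\<^sub>0 int) set set set" where
  "positive_cone C N = {K_class C N X | X. X \<in> Obj C \<and> \<not> is_zero_object C X}"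


section \<open>Weak stability conditions\<close>

text \<open>
  The totally ordered set is a type of class \<open>linorder\<close>. A map \<open>\<tau>\<close> on the positive cone is
  represented by a total function on the classes, whose values elsewhere are irrelevant.
\<close>

definition weak_stability_condition ::
    "('o, 'm, 'z) add_cat_scheme \<Rightarrow> ('o \<Rightarrow>\<^sub>0 int) set set \<Rightarrow>
     (('o \<Rightarrow>\<^sub>0 int) set set \<Rightarrow> 't::linorder) \<Rightarrow> bool" where
  "weak_stability_condition C N \<tau> \<longleftrightarrow>
     (\<forall>\<alpha>\<in>positive_cone C N. \<forall>\<beta>\<in>positive_cone C N. \<forall>\<gamma>\<in>positive_cone C N.
        \<beta> = \<alpha> \<otimes>\<^bsub>K_group C N\<^esub> \<gamma> \<longrightarrow>
        (\<tau> \<alpha> \<le> \<tau> \<beta> \<and> \<tau> \<beta> \<le> \<tau> \<gamma>) \<or> (\<tau> \<alpha> \<ge> \<tau> \<beta> \<and> \<tau> \<beta> \<ge> \<tau> \<gamma>))"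

definition semistable ::
    "('o, 'm, 'z) add_cat_scheme \<Rightarrow> ('o \<Rightarrow>\<^sub>0 int) set set \<Rightarrow>
     (('o \<Rightarrow>\<^sub>0 int) set set \<Rightarrow> 't::linorder) \<Rightarrow> 'o \<Rightarrow> bool" where
  "semistable C N \<tau> X \<longleftrightarrow> X \<in> Obj C \<and> \<not> is_zero_object C X \<and>
     (\<forall>S\<in>subobjects C X. S \<noteq> zero_subobject C X \<and> S \<noteq> whole_subobject C X \<longrightarrow>
        \<tau> (K_class C N (subobject_dom C S)) \<le>
        \<tau> (K_class C N (subquotient C (whole_subobject C X) S)))"

text \<open>
  Along a strictly descending infinite chain no term is zero, so \<open>\<tau>\<close> is only applied to
  classes of nonzero objects below.
\<close>

definition artinian_wrt ::
    "('o, 'm, 'z) add_cat_scheme \<Rightarrow> ('o \<Rightarrow>\<^sub>0 int) set set \<Rightarrow>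
     (('o \<Rightarrow>\<^sub>0 int) set set \<Rightarrow> 't::linorder) \<Rightarrow> bool" where
  "artinian_wrt C N \<tau> \<longleftrightarrow> \<not> (\<exists>X\<in>Obj C. \<exists>A :: nat \<Rightarrow> 'm set.
     (\<forall>n. A n \<in> subobjects C X) \<and>
     (\<forall>n. subobject_le C (A (Suc n)) (A n) \<and> A (Suc n) \<noteq> A n \<and>
          \<tau> (K_class C N (subobject_dom C (A (Suc n)))) \<ge>
          \<tau> (K_class C N (subquotient C (A n) (A (Suc n))))))"

text \<open>
  A filtration \<open>0 = A\<^sub>0 \<subset> \<dots> \<subset> A\<^sub>n = X\<close> is the list of its \<open>n + 1\<close> terms, so that its
  length is part of the data. The factor \<open>S\<^sub>k\<close> is \<open>A\<^sub>k / A\<^sub>k\<^sub>-\<^sub>1\<close>; as semistable objects are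
  nonzero, the inclusions are strict.
\<close>

definition filtration_factor ::
    "('o, 'm, 'z) add_cat_scheme \<Rightarrow> 'm set list \<Rightarrow> nat \<Rightarrow> 'o" where
  "filtration_factor C A k = subquotient C (A ! k) (A ! (k - 1))"

definition HN_filtration ::
    "('o, 'm, 'z) add_cat_scheme \<Rightarrow> ('o \<Rightarrow>\<^sub>0 int) set set \<Rightarrow>
     (('o \<Rightarrow>\<^sub>0 int) set set \<Rightarrow> 't::linorder) \<Rightarrow> 'o \<Rightarrow> 'm set list \<Rightarrow> bool" where
  "HN_filtration C N \<tau> X A \<longleftrightarrow> (\<exists>n. length A = n + 1 \<and>
     set A \<subseteq> subobjects C X \<and>
     A ! 0 = zero_subobject C X \<and> A ! n = whole_subobject C X \<and>
     (\<forall>k\<in>{1..n}. subobject_le C (A ! (k - 1)) (A ! k)) \<and>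
     (\<forall>k\<in>{1..n}. semistable C N \<tau> (filtration_factor C A k)) \<and>
     (\<forall>k\<in>{1..<n}. \<tau> (K_class C N (filtration_factor C A k)) >
                   \<tau> (K_class C N (filtration_factor C A (k + 1)))))"

end

theory Submission
  imports Defs
begin

text \<open>
  Identify a subobject of \<open>X\<close> with the sieve of arrows into \<open>X\<close> that factor through it. Then
  inclusion of subobjects is inclusion of sets, meets are intersections, and the subobjects of
  \<open>X\<close> form a lattice on which \<open>\<phi> S T = \<tau> [T/S]\<close> satisfies the second isomorphism theorem and the
  seesaw inequalities. Subobjects of \<open>T/S\<close> correspond to the interval from \<open>S\<close> to \<open>T\<close>, so
  semistability and the chain condition of \<open>\<tau>\<close>-artinian categories become conditions on this lattice.

  In the lattice, given \<open>U < X\<close>, consider for each \<open>c\<close> the \<open>T > U\<close> such that \<open>\<phi> V T \<ge> c\<close> whenever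
  \<open>U \<le> V < T\<close> and \<open>\<phi> T R < c\<close> whenever \<open>T < R\<close>. A minimal \<open>A\<close> among all of them is
  semistable and \<open>\<phi> A R < \<phi> U A\<close> for all \<open>R > A\<close>, so it is the first step of a filtration, which
  is completed by noetherian induction. For uniqueness, let \<open>A\<close> be the first step of one filtration
  and \<open>k\<close> the least index with \<open>A \<le> B\<^sub>k\<close> in another one; semistability gives
  \<open>\<phi> U A \<le> \<phi> B\<^sub>k\<^sub>-\<^sub>1 B\<^sub>k \<le> \<phi> U B\<^sub>1\<close>, with a strict inequality unless \<open>k = 1\<close>.
\<close>

section \<open>Slopes on lattices of sets\<close>

text \<open>\<open>X\<close> stays fixed while the lower end \<open>U\<close> moves up, so
  \<open>artinian\<close> is stated relative to \<open>U\<close>: it is the chain condition for the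
  object X/U. Joins enter only as least upper bounds, with the equality of slopes that the second
  isomorphism theorem gives.\<close>

locale slope_lattice =
  fixes L :: "'a set set" and X :: "'a set" and \<phi> :: "'a set \<Rightarrow> 'a set \<Rightarrow> 't::linorder"
  assumes top_mem: "X \<in> L" and le_top: "S \<in> L \<Longrightarrow> S \<subseteq> X"
    and Int_mem: "\<lbrakk>S \<in> L; T \<in> L\<rbrakk> \<Longrightarrow> S \<inter> T \<in> L"
    and second_iso: "\<lbrakk>S \<in> L; T \<in> L\<rbrakk> \<Longrightarrow> \<exists>J\<in>L. S \<subseteq> J \<and> T \<subseteq> J \<and>
      (\<forall>R\<in>L. S \<subseteq> R \<longrightarrow> T \<subseteq> R \<longrightarrow> J \<subseteq> R) \<and> \<phi> (S \<inter> T) S = \<phi> T J"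
    and seesaw: "\<lbrakk>S \<in> L; T \<in> L; R \<in> L; S \<subset> T; T \<subset> R\<rbrakk> \<Longrightarrow>
      \<phi> S T \<le> \<phi> S R \<and> \<phi> S R \<le> \<phi> T R \<or> \<phi> S T \<ge> \<phi> S R \<and> \<phi> S R \<ge> \<phi> T R"
    and noetherian: "\<And>A :: nat \<Rightarrow> 'a set. \<lbrakk>\<And>n. A n \<in> L; \<And>n. A n \<subset> A (Suc n)\<rbrakk> \<Longrightarrow> False"
    and artinian: "\<And>U A. \<lbrakk>U \<in> L; \<And>n. A n \<in> L; \<And>n. U \<subset> A n; \<And>n. A (Suc n) \<subset> A n;
      \<And>n. \<phi> (A (Suc n)) (A n) \<le> \<phi> U (A (Suc n))\<rbrakk> \<Longrightarrow> False"
begin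

text \<open>This holds vacuously for \<open>S = T\<close>; that a semistable quotient is nonzero is
  recorded by a separate strict inclusion.\<close>

definition sst :: "'a set \<Rightarrow> 'a set \<Rightarrow> bool" where
  "sst S T \<longleftrightarrow> (\<forall>R\<in>L. S \<subset> R \<longrightarrow> R \<subset> T \<longrightarrow> \<phi> S R \<le> \<phi> R T)"

text \<open>The list holds the terms strictly above \<open>U\<close>. With \<open>U\<close> left
  out, the tail is a filtration of the same kind starting from \<open>A\<close>, as induction
  requires.\<close>

fun hn :: "'a set \<Rightarrow> 'a set list \<Rightarrow> bool" where
  "hn U [] \<longleftrightarrow> U = X"
| "hn U [A] \<longleftrightarrow> U \<subset> A \<and> sst U A \<and> A = X"
| "hn U (A # B # As) \<longleftrightarrow> A \<in> L \<and> U \<subset> A \<and> sst U A \<and> \<phi> A B < \<phi> U A \<and> hn A (B # As)"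

text \<open>By \<open>seesaw\<close>, \<open>\<phi> S T\<close> lies between
  \<open>\<phi> S R\<close> and \<open>\<phi> R T\<close>, and semistability orders these
  two.\<close>

lemma sst_sub: "\<lbrakk>sst S T; S \<in> L; R \<in> L; T \<in> L; S \<subset> R; R \<subseteq> T\<rbrakk> \<Longrightarrow> \<phi> S R \<le> \<phi> S T"
  unfolding sst_def using seesaw[of S R T] by (metis order.trans psubsetI order_refl)

lemma sst_quot: "\<lbrakk>sst S T; S \<in> L; R \<in> L; T \<in> L; S \<subseteq> R; R \<subset> T\<rbrakk> \<Longrightarrow> \<phi> S T \<le> \<phi> R T"
  unfolding sst_def using seesaw[of S R T] by (metis order.trans psubsetI order_refl)

section \<open>Existence of a filtration\<close>

lemma wf_noetherian: "wf {(T, S). S \<in> L \<and> T \<in> L \<and> S \<subset> T}"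
  unfolding wf_iff_no_infinite_down_chain using noetherian by blast

text \<open>The relation in \<open>wf_noetherian\<close> puts larger sets first, so its minimal
  elements are maximal sets.\<close>

lemma maximal_exists:
  assumes "P T" "\<And>T. P T \<Longrightarrow> T \<in> L"
  obtains M where "P M" "\<And>R. R \<in> L \<Longrightarrow> M \<subset> R \<Longrightarrow> \<not> P R"
proof -
  from wfE_min[OF wf_noetherian, of T "Collect P"] assms that show ?thesis
    by (smt (verit) case_prodI mem_Collect_eq)
qed

text \<open>If there were no such \<open>S\<close>, every candidate would have a destabilizing
  subobject, whose slope over \<open>U\<close> is at least as large by \<open>seesaw\<close>.
  Repeating this from \<open>T\<close> on gives a descending chain that \<open>artinian\<close>
  forbids.\<close>

lemma semistable_sub:
  assumes "U \<in> L" "T \<in> L" "U \<subset> T"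
  obtains S where "S \<in> L" "U \<subset> S" "S \<subseteq> T" "sst U S" "\<phi> U T \<le> \<phi> U S"
proof (rule ccontr)
  assume no: "\<not> thesis"
  define P where "P S \<longleftrightarrow> S \<in> L \<and> U \<subset> S \<and> S \<subseteq> T \<and> \<phi> U T \<le> \<phi> U S" for S
  define Q where "Q S R \<longleftrightarrow> R \<subset> S \<and> \<phi> R S \<le> \<phi> U R" for S R
  have step: "\<exists>R. P R \<and> Q S R" if S: "P S" for S
  proof -
    have "\<not> sst U S"
      using S no that P_def \<open>\<And>S. \<lbrakk>S \<in> L; U \<subset> S; S \<subseteq> T; sst U S; \<phi> U T \<le> \<phi> U S\<rbrakk> \<Longrightarrow> thesis\<close> by blast
    then obtain R where R: "R \<in> L" "U \<subset> R" "R \<subset> S" "\<phi> R S < \<phi> U R"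
      unfolding sst_def by (auto simp: not_le)
    with S seesaw[of U R S] assms have "\<phi> U S \<le> \<phi> U R"
      unfolding P_def by auto
    with R S show ?thesis unfolding P_def Q_def by (meson order.trans less_imp_le psubset_imp_subset)
  qed
  have "P T" using assms by (simp add: P_def)
  then obtain A where A: "\<And>n. P (A n)" "\<And>n. Q (A n) (A (Suc n))"
    using dependent_nat_choice[of "\<lambda>_. P" "\<lambda>_. Q"] step by blast
  show False
    by (rule artinian[of U A]) (use A assms in \<open>auto simp: P_def Q_def\<close>)
qed

text \<open>The torsion part of X/U for the cut at slope \<open>c\<close>: the first bound concerns
  quotients of T/U, the second subobjects of X/T.\<close>

definition destab :: "'a set \<Rightarrow> 't \<Rightarrow> 'a set \<Rightarrow> bool" where
  "destab U c T \<longleftrightarrow> T \<in> L \<and> U \<subset> T \<and> (\<forall>V\<in>L. U \<subseteq> V \<longrightarrow> V \<subset> T \<longrightarrow> c \<le> \<phi> V T) \<and>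
     (\<forall>R\<in>L. T \<subset> R \<longrightarrow> \<phi> T R < c)"

text \<open>A maximal set satisfying the bound on quotients works; \<open>S\<close> satisfies it by
  semistability. If X/M had a subobject of too large a slope, it would contain a semistable one, and
  extending \<open>M\<close> by that one would preserve the bound.\<close>

lemma destab_exists:
  assumes U: "U \<in> L" "S \<in> L" "U \<subset> S" "sst U S"
  obtains T where "destab U (\<phi> U S) T"
proof -
  let ?c = "\<phi> U S"
  define P where "P T \<longleftrightarrow> T \<in> L \<and> U \<subset> T \<and> (\<forall>V\<in>L. U \<subseteq> V \<longrightarrow> V \<subset> T \<longrightarrow> ?c \<le> \<phi> V T)" for T
  have "P S" unfolding P_def using U sst_quot[of U S] by auto
  then obtain M where M: "P M" and max: "\<And>R. R \<in> L \<Longrightarrow> M \<subset> R \<Longrightarrow> \<not> P R"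
    by (rule maximal_exists[of P S]) (simp_all add: P_def)
  have M_mem: "M \<in> L" "U \<subset> M" using M by (auto simp: P_def)
  have "\<phi> M R < ?c" if R: "R \<in> L" "M \<subset> R" for R
  proof (rule ccontr)
    assume "\<not> \<phi> M R < ?c"
    moreover obtain R' where R': "R' \<in> L" "M \<subset> R'" "sst M R'" "\<phi> M R \<le> \<phi> M R'"
      using semistable_sub[of M R] M_mem R by metis
    ultimately have c: "?c \<le> \<phi> M R'" by auto
    have "?c \<le> \<phi> V R'" if V: "V \<in> L" "U \<subseteq> V" "V \<subset> R'" for V
    proof -
      have ge: "?c \<le> \<phi> W R'" if "W \<in> L" "M \<subseteq> W" "W \<subset> R'" for W
        using sst_quot[of M R' W] that c M_mem R' by auto
      show ?thesis
      proof (cases "M \<subseteq> V")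
        case False
        \<comment> \<open>R'/V is an extension of R'/J by J/V, with \<open>J\<close> the join of
          \<open>M\<close> and \<open>V\<close>. The slope of J/V is that of the quotient
          \<open>M/(M \<inter> V)\<close> of M/U, and R'/J is zero or a quotient of the semistable
          R'/M, so \<open>seesaw\<close> carries the bound over to R'/V.\<close>
        obtain J where J: "J \<in> L" "M \<subseteq> J" "V \<subseteq> J" "J \<subseteq> R'" "\<phi> (M \<inter> V) M = \<phi> V J"
          using second_iso[of M V] M_mem V R' by (metis psubset_imp_subset)
        have "M \<inter> V \<in> L" "U \<subseteq> M \<inter> V" "M \<inter> V \<subset> M"
          using Int_mem[of M V] V False M_mem by auto
        then have "?c \<le> \<phi> (M \<inter> V) M" using M by (simp add: P_def)
        then have "?c \<le> \<phi> V J" by (simp add: J)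
        moreover have "J = R' \<or> ?c \<le> \<phi> J R'" using ge[of J] J by auto
        moreover have "V \<subset> J" using J False by auto
        ultimately show ?thesis
          using seesaw[of V J R'] V J R' by (metis order.trans psubsetI)
      qed (use ge V in auto)
    qed
    then have "P R'" unfolding P_def using R' M_mem by auto
    then show False using max R' by blast
  qed
  with M have "destab U ?c M" by (auto simp: P_def destab_def)
  then show ?thesis by (rule that)
qed

text \<open>Otherwise \<open>T'/(T' \<inter> T)\<close> would be a nonzero quotient of T'/U, of
  slope at least \<open>d\<close>, and would share its slope with a nonzero subobject J/T of X/T,
  which is below \<open>c\<close>.\<close>

lemma destab_antimono:
  assumes "destab U c T" "destab U d T'" "c \<le> d" "U \<in> L"
  shows "T' \<subseteq> T"
proof (rule ccontr)
  assume no: "\<not> T' \<subseteq> T"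
  obtain J where J: "J \<in> L" "T' \<subseteq> J" "T \<subseteq> J" "\<phi> (T' \<inter> T) T' = \<phi> T J"
    using second_iso[of T' T] assms by (auto simp: destab_def)
  have "T' \<inter> T \<in> L" "U \<subseteq> T' \<inter> T" "T' \<inter> T \<subset> T'"
    using assms no Int_mem[of T' T] by (auto simp: destab_def)
  then have "d \<le> \<phi> (T' \<inter> T) T'"
    using assms(2) by (simp add: destab_def)
  moreover have "T \<subset> J" using J no by auto
  then have "\<phi> T J < c" using assms(1) J by (simp add: destab_def)
  ultimately show False using J assms(3) by auto
qed

text \<open>The set \<open>A\<close> is minimal among the \<open>T\<close> with \<open>destab U c T\<close> for some \<open>c\<close>. It exists by
  \<open>artinian\<close>: along a strictly descending chain of such \<open>T\<close> the values \<open>c\<close> increase.\<close>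

lemma maximal_destabilizing:
  assumes U: "U \<in> L" "U \<subset> X"
  obtains A where "A \<in> L" "U \<subset> A" "sst U A" "\<And>R. R \<in> L \<Longrightarrow> A \<subset> R \<Longrightarrow> \<phi> A R < \<phi> U A"
proof -
  obtain T c where Tc: "destab U c T"
    and min: "\<And>T' c'. destab U c' T' \<Longrightarrow> \<not> T' \<subset> T"
  proof (rule ccontr)
    assume "\<not> thesis"
    then have step: "\<exists>T' c'. destab U c' T' \<and> T' \<subset> T" if "destab U c T" for T c
      using that \<open>\<And>T c. \<lbrakk>destab U c T; \<And>T' c'. destab U c' T' \<Longrightarrow> \<not> T' \<subset> T\<rbrakk> \<Longrightarrow> thesis\<close> by blast
    obtain S where "S \<in> L" "U \<subset> S" "sst U S"
      using semistable_sub[of U X] U top_mem by metis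
    then obtain T0 where "destab U (\<phi> U S) T0"
      using destab_exists U by metis
    then have "\<exists>A. \<forall>n. (\<exists>c. destab U c (A n)) \<and> A (Suc n) \<subset> A n"
      by (intro dependent_nat_choice) (blast, meson step)
    then obtain A where A: "\<And>n. \<exists>c. destab U c (A n)" "\<And>n. A (Suc n) \<subset> A n"
      by metis
    show False
    proof (rule artinian[of U A])
      fix n
      \<comment> \<open>The threshold \<open>d\<close> of the later term separates the two slopes:
        \<open>A n\<close> over \<open>A (Suc n)\<close> has slope below \<open>d\<close>, and
        \<open>A (Suc n)\<close> over \<open>U\<close> has slope at least \<open>d\<close>.\<close>
      obtain c d where cd: "destab U c (A n)" "destab U d (A (Suc n))" using A by metis
      have "\<not> d \<le> c" using destab_antimono[OF cd(2,1)] A(2)[of n] U by auto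
      moreover have "\<phi> (A (Suc n)) (A n) < d" "d \<le> \<phi> U (A (Suc n))"
        using cd A(2)[of n] U unfolding destab_def by auto
      ultimately show "\<phi> (A (Suc n)) (A n) \<le> \<phi> U (A (Suc n))" by auto
      show "A n \<in> L" "U \<subset> A n" using A(1)[of n] by (auto simp: destab_def)
    qed (use A U in auto)
  qed
  have T: "T \<in> L" "U \<subset> T" using Tc by (auto simp: destab_def)
  \<comment> \<open>The threshold of \<open>T\<close> can be raised to \<open>\<phi> U S\<close>:
    the set \<open>T'\<close> belonging to it lies in \<open>T\<close> by
    \<open>destab_antimono\<close> and equals \<open>T\<close> by minimality. Taking
    \<open>V = U\<close> in \<open>destab\<close> then bounds \<open>\<phi> U S\<close> by
    \<open>\<phi> U T\<close>.\<close>
  have dest: "destab U (\<phi> U S) T" "\<phi> U S \<le> \<phi> U T"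
    if S: "S \<in> L" "U \<subset> S" "S \<subseteq> T" "sst U S" "\<phi> U T \<le> \<phi> U S \<or> c \<le> \<phi> U S" for S
  proof -
    obtain T' where T': "destab U (\<phi> U S) T'" using destab_exists U S by metis
    have "c \<le> \<phi> U T" using Tc U unfolding destab_def by auto
    then have "c \<le> \<phi> U S" using S(5) by auto
    then have "T' \<subseteq> T" using destab_antimono[OF Tc T'] U by simp
    then have "T' = T" using min[OF T'] by auto
    then show "destab U (\<phi> U S) T" using T' by simp
    then show "\<phi> U S \<le> \<phi> U T" using U unfolding destab_def by auto
  qed
  \<comment> \<open>A subobject of larger slope would contain a semistable one of larger slope,
    against \<open>dest\<close>.\<close>
  have T_max: "\<phi> U V \<le> \<phi> U T" if V: "V \<in> L" "U \<subset> V" "V \<subseteq> T" for V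
  proof (rule ccontr)
    assume *: "\<not> \<phi> U V \<le> \<phi> U T"
    obtain S where S: "S \<in> L" "U \<subset> S" "S \<subseteq> V" "sst U S" "\<phi> U V \<le> \<phi> U S"
      using semistable_sub[of U V] U V by metis
    then have "S \<subseteq> T" "\<phi> U T \<le> \<phi> U S" using V * by auto
    then show False using dest(2)[of S] S * by auto
  qed
  \<comment> \<open>A semistable \<open>S\<close> in \<open>T\<close> of slope at least
    \<open>\<phi> U T\<close> has exactly this slope by \<open>dest\<close>, so
    \<open>\<phi> U T\<close> itself is a threshold. Quotients of T/U then have at least this slope
    and subobjects at most, which is semistability.\<close>
  obtain S where "S \<in> L" "U \<subset> S" "S \<subseteq> T" "sst U S" "\<phi> U T \<le> \<phi> U S"
    using semistable_sub[of U T] U T by metis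
  with dest[of S] have d: "destab U (\<phi> U T) T" by (metis order.antisym)
  have "sst U T" unfolding sst_def
  proof (intro ballI impI)
    fix R assume "R \<in> L" "U \<subset> R" "R \<subset> T"
    then show "\<phi> U R \<le> \<phi> R T" using T_max[of R] d unfolding destab_def
      by (meson order.trans psubset_imp_subset)
  qed
  with d T show ?thesis by (intro that[of T]) (auto simp: destab_def)
qed

lemma hn_exists: "U \<in> L \<Longrightarrow> \<exists>As. hn U As"
proof (induction U rule: wf_induct_rule[OF wf_noetherian])
  case (1 U)
  show ?case
  proof (cases "U = X")
    case True
    then show ?thesis by (intro exI[of _ "[]"]) simp
  next
    case False
    then obtain A where A: "A \<in> L" "U \<subset> A" "sst U A" "\<And>R. R \<in> L \<Longrightarrow> A \<subset> R \<Longrightarrow> \<phi> A R < \<phi> U A"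
      using maximal_destabilizing[of U] le_top[of U] 1(2) by blast
    then obtain As where As: "hn A As" using 1 by blast
    have "hn U (A # As)"
    \<comment> \<open>The rule serves for its split into empty, one-element and longer lists, as in
      the equations of \<open>hn\<close>. An empty tail means \<open>A = X\<close>; in a one-element
      tail \<open>[B]\<close>, \<open>B = X\<close>.\<close>
    proof (cases As rule: remdups_adj.cases)
      case 1 with A As show ?thesis by simp
    next
      case (2 B) with A(1-3) A(4)[of X] As top_mem show ?thesis by auto
    next
      case (3 B B' Bs) with A As show ?thesis by simp
    qed
    then show ?thesis by blast
  qed
qed

section \<open>Uniqueness of the filtration\<close>

lemma hn_Cons: "hn U (A # As) \<longleftrightarrow> A \<in> L \<and> U \<subset> A \<and> sst U A \<and> hn A As \<and>
    (As \<noteq> [] \<longrightarrow> \<phi> A (hd As) < \<phi> U A)"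
  using top_mem by (cases As) auto


text \<open>T/S is a first step to be compared with another filtration, \<open>S\<close> being fixed
  while \<open>U\<close> climbs along the list. Once \<open>T\<close> lies in the next term
  \<open>B\<close>, the quotient \<open>T/(T \<inter> U)\<close> of T/S has the slope of a subobject
  J/U of B/U, and semistability of both gives the inequality. Before that, the drop of slopes makes
  it strict.\<close>

lemma hn_first:
  assumes "S \<in> L" "T \<in> L" "S \<subset> T" "sst S T"
  shows "\<lbrakk>U \<in> L; hn U Bs; S \<subseteq> U; \<not> T \<subseteq> U\<rbrakk> \<Longrightarrow> Bs \<noteq> [] \<and> \<phi> S T \<le> \<phi> U (hd Bs) \<and>
     (T \<subseteq> hd Bs \<or> \<phi> S T < \<phi> U (hd Bs))"
proof (induction Bs arbitrary: U)
  case Nil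
  then show ?case using le_top assms by auto
next
  case (Cons B Bs)
  have B: "B \<in> L" "U \<subset> B" "sst U B" "hn B Bs" using Cons.prems by (auto simp: hn_Cons)
  show ?case
  proof (cases "T \<subseteq> B")
    case True
    obtain J where J: "J \<in> L" "T \<subseteq> J" "U \<subseteq> J" "J \<subseteq> B" "\<phi> (T \<inter> U) T = \<phi> U J"
      using second_iso[of T U] assms Cons.prems B True by (metis psubset_imp_subset)
    have "\<phi> S T \<le> \<phi> (T \<inter> U) T"
      by (rule sst_quot) (use assms Cons.prems Int_mem in auto)
    also have "\<dots> \<le> \<phi> U B"
      unfolding J by (rule sst_sub) (use J B Cons.prems in auto)
    finally show ?thesis using True by simp
  next
    case False
    then have "Bs \<noteq> []" "\<phi> S T \<le> \<phi> B (hd Bs)" using Cons.IH[of B] B Cons.prems by auto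
    moreover have "\<phi> B (hd Bs) < \<phi> U B" using Cons.prems \<open>Bs \<noteq> []\<close> by (simp add: hn_Cons)
    ultimately show ?thesis by auto
  qed
qed

text \<open>Applied in both directions, \<open>hn_first\<close> bounds each first slope by the
  other. So neither inequality is strict, and each first term contains the other.\<close>

lemma hn_unique: "\<lbrakk>U \<in> L; hn U As; hn U Bs\<rbrakk> \<Longrightarrow> As = Bs"
proof (induction As arbitrary: U Bs)
  case Nil
  then show ?case using le_top by (cases Bs) (auto simp: hn_Cons)
next
  case (Cons A As)
  then have A: "A \<in> L" "U \<subset> A" "sst U A" "hn A As" by (auto simp: hn_Cons)
  then obtain B Cs where Bs: "Bs = B # Cs" using Cons.prems le_top by (cases Bs) auto
  have B: "B \<in> L" "U \<subset> B" "sst U B" "hn B Cs" using Cons.prems by (auto simp: hn_Cons Bs)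
  have "\<phi> U A \<le> \<phi> U B \<and> (A \<subseteq> B \<or> \<phi> U A < \<phi> U B)"
    using hn_first[of U A U Bs] A Cons.prems Bs by auto
  moreover have "\<phi> U B \<le> \<phi> U A \<and> (B \<subseteq> A \<or> \<phi> U B < \<phi> U A)"
    using hn_first[of U B U "A # As"] B Cons.prems by auto
  ultimately have "A = B" by auto
  with Cons.IH[of A Cs] A B show ?case by (simp add: Bs)
qed

section \<open>Filtrations as indexed lists with both end terms, in the shape of
  \<open>HN_filtration\<close>\<close>

definition hn_chain :: "'a set \<Rightarrow> 'a set list \<Rightarrow> bool" where
  "hn_chain U B \<longleftrightarrow> (\<exists>n. length B = n + 1 \<and> set B \<subseteq> L \<and> B ! 0 = U \<and> B ! n = X \<and>
     (\<forall>k\<in>{1..n}. B ! (k - 1) \<subset> B ! k \<and> sst (B ! (k - 1)) (B ! k)) \<and>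
     (\<forall>k\<in>{1..<n}. \<phi> (B ! k) (B ! (k + 1)) < \<phi> (B ! (k - 1)) (B ! k)))"

lemma hn_chain_Cons: "U \<in> L \<Longrightarrow> hn_chain U (U # As) \<longleftrightarrow> hn U As"
proof (induction As arbitrary: U)
  case Nil
  then show ?case by (auto simp: hn_chain_def)
next
  case (Cons A As)
  define n where "n = length As"
  \<comment> \<open>Splitting off index 1 and shifting the others turns the conditions on
    \<open>U # A # As\<close> into those on \<open>A # As\<close>. For slopes the range is empty if
    \<open>n = 0\<close>, hence the guard in \<open>all2\<close>.\<close>
  have all1: "(\<forall>k\<in>{1..Suc n}. P k) \<longleftrightarrow> P 1 \<and> (\<forall>k\<in>{1..n}. P (Suc k))" for P
  proof -
    have "{1..Suc n} = insert 1 (Suc ` {1..n})"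
      by (auto simp: image_iff Suc_le_eq dest: Suc_le_D)
    then show ?thesis by (simp only: ball_simps)
  qed
  have all2: "(\<forall>k\<in>{1..<Suc n}. P k) \<longleftrightarrow> (n > 0 \<longrightarrow> P 1) \<and> (\<forall>k\<in>{1..<n}. P (Suc k))" for P
  proof (cases "n > 0")
    case True
    then have "{1..<Suc n} = insert 1 (Suc ` {1..<n})"
      using True by (auto simp: image_iff)
    then show ?thesis using True by (simp only: ball_simps simp_thms)
  qed simp
  have hd: "n > 0 \<Longrightarrow> As ! 0 = hd As" "As \<noteq> [] \<longleftrightarrow> n > 0"
    by (auto simp: n_def hd_conv_nth)
  have "hn_chain U (U # A # As) \<longleftrightarrow> A \<in> L \<and> U \<subset> A \<and> sst U A \<and> hn_chain A (A # As) \<and>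
    (As \<noteq> [] \<longrightarrow> \<phi> A (hd As) < \<phi> U A)"
    using Cons.prems unfolding hn_chain_def
    by (auto simp: n_def[symmetric] all1[unfolded One_nat_def] all2[unfolded One_nat_def] hd
        nth_Cons' split: if_splits)
  then show ?case using Cons.IH[of A] by (auto simp: hn_Cons)
qed

lemma ex1_hn_chain: assumes "U \<in> L" shows "\<exists>!B. hn_chain U B"
proof -
  obtain As where As: "hn U As" using hn_exists assms by blast
  have "B = U # As" if "hn_chain U B" for B
  proof -
    from that obtain Bs where "B = U # Bs" by (cases B) (auto simp: hn_chain_def)
    with that show ?thesis using hn_chain_Cons hn_unique As assms by blast
  qed
  then show ?thesis using hn_chain_Cons As assms by blast
qed

end

section \<open>Sieves of monomorphisms\<close>

context category begin

section \<open>Rules for composition, monomorphisms and epimorphisms\<close>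

lemma comp_arr [simp]:
  assumes "f \<in> Arr C" "g \<in> Arr C" "Cod C f = Dom C g"
  shows "g \<cdot> f \<in> Arr C" "Dom C (g \<cdot> f) = Dom C f" "Cod C (g \<cdot> f) = Cod C g"
  using Comp_Hom[of f "Dom C f" "Cod C f" g "Cod C g"] assms by (auto simp: Hom_def)

lemma comp_assoc:
  "\<lbrakk>f \<in> Arr C; g \<in> Arr C; h \<in> Arr C; Cod C f = Dom C g; Cod C g = Dom C h\<rbrakk>
    \<Longrightarrow> h \<cdot> g \<cdot> f = h \<cdot> (g \<cdot> f)"
  using Comp_assoc[of f "Dom C f" "Cod C f" g "Cod C g" h "Cod C h"] by (auto simp: Hom_def)

lemma ident_arr [simp]:
  assumes "X \<in> Obj C"
  shows "Ident C X \<in> Arr C" "Dom C (Ident C X) = X" "Cod C (Ident C X) = X"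
  using Ident_Hom[OF assms] by (auto simp: Hom_def)

lemma comp_ident [simp]:
  "\<lbrakk>f \<in> Arr C; Dom C f = X\<rbrakk> \<Longrightarrow> f \<cdot> Ident C X = f"
  "\<lbrakk>f \<in> Arr C; Cod C f = X\<rbrakk> \<Longrightarrow> Ident C X \<cdot> f = f"
  using Comp_Ident_right[of f "Dom C f" "Cod C f"] Comp_Ident_left[of f "Dom C f" "Cod C f"]
  by (auto simp: Hom_def)

lemma dom_cod_obj [simp]: "f \<in> Arr C \<Longrightarrow> Dom C f \<in> Obj C" "f \<in> Arr C \<Longrightarrow> Cod C f \<in> Obj C"
  by (simp_all add: Dom_Obj Cod_Obj)

lemma mono_arr [simp]: "is_mono C f \<Longrightarrow> f \<in> Arr C"
  by (simp add: is_mono_def)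

lemma epi_arr [simp]: "is_epi C f \<Longrightarrow> f \<in> Arr C"
  by (simp add: is_epi_def)

lemma mono_cancel:
  assumes "is_mono C f" "f \<cdot> g = f \<cdot> h" "g \<in> Arr C" "h \<in> Arr C"
    "Cod C g = Dom C f" "Cod C h = Dom C f" "Dom C g = Dom C h"
  shows "g = h"
proof -
  have "g \<in> Hom C (Dom C g) (Dom C f)" "h \<in> Hom C (Dom C g) (Dom C f)" "Dom C g \<in> Obj C"
    using assms(3-7) by (simp_all add: Hom_def)
  with assms(1,2) show ?thesis by (simp add: is_mono_def)
qed

lemma epi_cancel:
  assumes "is_epi C f" "g \<cdot> f = h \<cdot> f" "g \<in> Arr C" "h \<in> Arr C"
    "Dom C g = Cod C f" "Dom C h = Cod C f" "Cod C g = Cod C h"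
  shows "g = h"
proof -
  have "g \<in> Hom C (Cod C f) (Cod C g)" "h \<in> Hom C (Cod C f) (Cod C g)" "Cod C g \<in> Obj C"
    using assms(3-7) by (simp_all add: Hom_def)
  with assms(1,2) show ?thesis by (simp add: is_epi_def)
qed

lemma mono_comp:
  assumes "is_mono C f" "is_mono C g" "Cod C f = Dom C g"
  shows "is_mono C (g \<cdot> f)"
  unfolding is_mono_def
proof (intro conjI ballI impI)
  fix W a b assume "a \<in> Hom C W (Dom C (g \<cdot> f))" "b \<in> Hom C W (Dom C (g \<cdot> f))"
    and eq: "g \<cdot> f \<cdot> a = g \<cdot> f \<cdot> b"
  then have ab: "a \<in> Arr C" "b \<in> Arr C" "Cod C a = Dom C f" "Cod C b = Dom C f" "Dom C a = Dom C b"
    using assms by (auto simp: Hom_def)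
  have "g \<cdot> (f \<cdot> a) = g \<cdot> (f \<cdot> b)" using eq ab assms by (simp add: comp_assoc)
  then have "f \<cdot> a = f \<cdot> b" by (rule mono_cancel[OF assms(2)]) (use assms ab in auto)
  then show "a = b" by (rule mono_cancel[OF assms(1)]) (use ab in auto)
qed (use assms in auto)

lemma epi_comp:
  assumes "is_epi C f" "is_epi C g" "Cod C f = Dom C g"
  shows "is_epi C (g \<cdot> f)"
  unfolding is_epi_def
proof (intro conjI ballI impI)
  fix W a b assume "a \<in> Hom C (Cod C (g \<cdot> f)) W" "b \<in> Hom C (Cod C (g \<cdot> f)) W"
    and eq: "a \<cdot> (g \<cdot> f) = b \<cdot> (g \<cdot> f)"
  then have ab: "a \<in> Arr C" "b \<in> Arr C" "Dom C a = Cod C g" "Dom C b = Cod C g" "Cod C a = Cod C b"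
    using assms by (auto simp: Hom_def)
  have "a \<cdot> g \<cdot> f = b \<cdot> g \<cdot> f" using eq ab assms by (simp add: comp_assoc)
  then have "a \<cdot> g = b \<cdot> g" by (rule epi_cancel[OF assms(1)]) (use assms ab in auto)
  then show "a = b" by (rule epi_cancel[OF assms(2)]) (use ab in auto)
qed (use assms in auto)

text \<open>The principal sieve generated by \<open>i\<close>. Unlike \<open>i\<close>, it does not
  change under isomorphisms of the domain.\<close>

definition sieve where
  "sieve i = {h \<in> Arr C. Cod C h = Cod C i \<and>
     (\<exists>u\<in>Arr C. Dom C u = Dom C h \<and> Cod C u = Dom C i \<and> h = i \<cdot> u)}"

definition sieves where
  "sieves X = {sieve i | i. is_mono C i \<and> Cod C i = X}"

lemma mem_sieve: "i \<in> Arr C \<Longrightarrow> i \<in> sieve i"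
  unfolding sieve_def by (auto intro!: bexI[of _ "Ident C (Dom C i)"])

lemma sieve_subset_iff:
  assumes "i \<in> Arr C" "j \<in> Arr C"
  shows "sieve i \<subseteq> sieve j \<longleftrightarrow> i \<in> sieve j"
proof
  assume "i \<in> sieve j"
  then obtain u where u: "u \<in> Arr C" "Dom C u = Dom C i" "Cod C u = Dom C j" "i = j \<cdot> u"
    by (auto simp: sieve_def)
  show "sieve i \<subseteq> sieve j"
  proof
    fix h assume "h \<in> sieve i"
    then obtain v where v: "v \<in> Arr C" "Dom C v = Dom C h" "Cod C v = Dom C i" "h = i \<cdot> v" "h \<in> Arr C"
      by (auto simp: sieve_def)
    have "j \<cdot> u \<cdot> v = j \<cdot> (u \<cdot> v)" by (rule comp_assoc) (use u v assms in simp_all)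
    then have "h = j \<cdot> (u \<cdot> v)" using u v by simp
    then show "h \<in> sieve j" unfolding sieve_def using u v assms
      by (auto intro!: bexI[of _ "u \<cdot> v"])
  qed
qed (use mem_sieve assms in blast)

lemma mem_sieveI: "\<lbrakk>i \<in> Arr C; u \<in> Arr C; Cod C u = Dom C i\<rbrakk> \<Longrightarrow> i \<cdot> u \<in> sieve i"
  by (auto simp: sieve_def)

lemma cod_sieve: "h \<in> sieve i \<Longrightarrow> Cod C h = Cod C i"
  by (simp add: sieve_def)

lemma mem_sieveE:
  assumes "h \<in> sieve i"
  obtains u where "u \<in> Arr C" "Dom C u = Dom C h" "Cod C u = Dom C i" "i \<cdot> u = h"
  using assms by (auto simp: sieve_def)

text \<open>Each monomorphism factors through the other, and cancelling them shows that the two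
  factors are mutually inverse.\<close>

lemma sieve_eq_imp_subobject:
  assumes "is_mono C i" "is_mono C j" "sieve i = sieve j"
  shows "\<exists>h\<in>Hom C (Dom C j) (Dom C i). is_iso C h \<and> j = i \<cdot> h"
proof -
  obtain u where u: "u \<in> Arr C" "Dom C u = Dom C j" "Cod C u = Dom C i" "i \<cdot> u = j"
    using assms mem_sieve[of j] by (auto elim: mem_sieveE)
  obtain v where v: "v \<in> Arr C" "Dom C v = Dom C i" "Cod C v = Dom C j" "j \<cdot> v = i"
    using assms mem_sieve[of i] by (auto elim: mem_sieveE)
  have "u \<cdot> v = Ident C (Dom C i)"
    by (rule mono_cancel[OF assms(1)]) (use u v assms in \<open>simp_all flip: comp_assoc\<close>)
  moreover have "v \<cdot> u = Ident C (Dom C j)"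
    by (rule mono_cancel[OF assms(2)]) (use u v assms in \<open>simp_all flip: comp_assoc\<close>)
  ultimately have "is_iso C u" using u v by (auto simp: is_iso_def Hom_def)
  then show ?thesis using u by (auto simp: Hom_def)
qed

lemma subobject_of_eq:
  assumes "is_mono C i"
  shows "subobject_of C i = {j. is_mono C j \<and> sieve j = sieve i}"
proof (intro equalityI subsetI)
  fix j assume "j \<in> subobject_of C i"
  then obtain h where j: "is_mono C j" "Cod C j = Cod C i" "h \<in> Arr C" "Dom C h = Dom C j"
      "Cod C h = Dom C i" "is_iso C h" "j = i \<cdot> h"
    by (auto simp: subobject_of_def Hom_def)
  then obtain g where g: "g \<in> Arr C" "Dom C g = Dom C i" "Cod C g = Dom C j" "h \<cdot> g = Ident C (Dom C i)"
    by (auto simp: is_iso_def Hom_def)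
  have "i \<cdot> h \<cdot> g = i \<cdot> (h \<cdot> g)" by (rule comp_assoc) (use j g assms in simp_all)
  then have "i = j \<cdot> g" using j g assms by simp
  then have "i \<in> sieve j" unfolding sieve_def using g(1-3) j(1,2) assms
    by (metis (mono_tags, lifting) mem_Collect_eq mono_arr)
  moreover have "j \<in> sieve i" using j by (auto simp: sieve_def)
  ultimately show "j \<in> {j. is_mono C j \<and> sieve j = sieve i}"
    using assms j(1) sieve_subset_iff[of i j] sieve_subset_iff[of j i] by auto
next
  fix j assume "j \<in> {j. is_mono C j \<and> sieve j = sieve i}"
  moreover from this have "Cod C j = Cod C i" using mem_sieve[of j] cod_sieve by auto
  ultimately show "j \<in> subobject_of C i"
    using sieve_eq_imp_subobject[OF assms, of j] by (auto simp: subobject_of_def)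
qed

section \<open>The order isomorphism between subobjects and sieves\<close>

definition sieve_of where
  "sieve_of S = sieve (SOME s. s \<in> S)"

definition subobject_of_sieve where
  "subobject_of_sieve V = {j. is_mono C j \<and> sieve j = V}"

text \<open>All representatives generate the same sieve, so the choice made in
  \<open>sieve_of\<close> does not matter.\<close>

lemma sieve_of_mem:
  assumes "S \<in> subobjects C X" "s \<in> S"
  shows "is_mono C s" "sieve s = sieve_of S" "Cod C s = X" "S = subobject_of_sieve (sieve s)"
proof -
  obtain i where i: "is_mono C i" "S = {j. is_mono C j \<and> sieve j = sieve i}" "Cod C i = X"
    using assms by (auto simp: subobjects_def subobject_of_eq)
  have "(SOME s. s \<in> S) \<in> S" using assms(2) by (rule someI)
  then show s: "is_mono C s" "sieve s = sieve_of S" "S = subobject_of_sieve (sieve s)"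
    using i assms by (auto simp: sieve_of_def subobject_of_sieve_def)
  show "Cod C s = X" using i assms mem_sieve[OF mono_arr[OF s(1)]] by (auto simp: cod_sieve)
qed

lemma subobject_nonempty: "S \<in> subobjects C X \<Longrightarrow> \<exists>s. s \<in> S"
  using mem_sieve by (auto simp: subobjects_def subobject_of_eq)

lemma bij_sieve_of: "bij_betw sieve_of (subobjects C X) (sieves X)"
proof (rule bij_betw_byWitness[where f' = subobject_of_sieve])
  show 1: "\<forall>S\<in>subobjects C X. subobject_of_sieve (sieve_of S) = S"
    using subobject_nonempty sieve_of_mem by metis
  have 2: "subobject_of_sieve (sieve i) \<in> subobjects C (Cod C i)" "i \<in> subobject_of_sieve (sieve i)"
    if "is_mono C i" for i
    using that subobject_of_eq[of i] by (auto simp: subobjects_def subobject_of_sieve_def)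
  then show "\<forall>V\<in>sieves X. sieve_of (subobject_of_sieve V) = V"
    using sieve_of_mem(2)[symmetric] unfolding sieves_def by blast
  show "sieve_of ` subobjects C X \<subseteq> sieves X"
  proof clarify
    fix S assume S: "S \<in> subobjects C X"
    then obtain s where "s \<in> S" using subobject_nonempty by blast
    from sieve_of_mem[OF S this] show "sieve_of S \<in> sieves X" unfolding sieves_def by blast
  qed
  show "subobject_of_sieve ` sieves X \<subseteq> subobjects C X"
    using 2 by (auto simp: sieves_def)
qed

lemma subobject_le_iff:
  assumes "S \<in> subobjects C X" "T \<in> subobjects C X"
  shows "subobject_le C S T \<longleftrightarrow> sieve_of S \<subseteq> sieve_of T"
proof
  assume "subobject_le C S T"
  then obtain s t f where *: "s \<in> S" "t \<in> T" "f \<in> Arr C" "Dom C f = Dom C s" "Cod C f = Dom C t" "s = t \<cdot> f"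
    by (auto simp: subobject_le_def Hom_def)
  then have "s \<in> sieve t" using sieve_of_mem(1)[OF assms(2), of t] mem_sieveI[of t f] by simp
  then show "sieve_of S \<subseteq> sieve_of T"
    using sieve_subset_iff[of s t] sieve_of_mem[OF assms(1), of s] sieve_of_mem[OF assms(2), of t] * by auto
next
  assume *: "sieve_of S \<subseteq> sieve_of T"
  obtain s t where st: "s \<in> S" "t \<in> T" using assms subobject_nonempty by blast
  then have "s \<in> sieve t"
    using sieve_subset_iff[of s t] sieve_of_mem[OF assms(1), of s] sieve_of_mem[OF assms(2), of t] * by auto
  then obtain u where "u \<in> Arr C" "Dom C u = Dom C s" "Cod C u = Dom C t" "t \<cdot> u = s"
    by (rule mem_sieveE)
  then have "u \<in> Hom C (Dom C s) (Dom C t)" "s = t \<cdot> u" by (simp_all add: Hom_def)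
  then show "subobject_le C S T" unfolding subobject_le_def using st by blast
qed

end

section \<open>Kernels, cokernels and images\<close>

context preadditive_category begin

section \<open>Zero arrows, and kernels and cokernels expressed through them\<close>

definition null where
  "null f \<longleftrightarrow> f = Zero C (Dom C f) (Cod C f)"

lemma zero_arr [simp]:
  assumes "X \<in> Obj C" "Y \<in> Obj C"
  shows "Zero C X Y \<in> Arr C" "Dom C (Zero C X Y) = X" "Cod C (Zero C X Y) = Y"
proof -
  interpret G: comm_group "Hom_group C X Y" using assms by (rule Hom_comm_group)
  show "Zero C X Y \<in> Arr C" "Dom C (Zero C X Y) = X" "Cod C (Zero C X Y) = Y"
    using G.one_closed by (auto simp: Hom_group_def Hom_def)
qed

lemma null_zero [simp]: "\<lbrakk>X \<in> Obj C; Y \<in> Obj C\<rbrakk> \<Longrightarrow> null (Zero C X Y)"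
  by (simp add: null_def)

lemma null_unique: "\<lbrakk>null f; null g; Dom C f = Dom C g; Cod C f = Cod C g\<rbrakk> \<Longrightarrow> f = g"
  by (metis null_def)

text \<open>The neutral element is the only idempotent of a group. Through additivity of composition
  this makes composites with zero arrows zero in \<open>null_comp\<close>.\<close>

lemma nullI_idem:
  assumes "f \<in> Arr C" "Plus C f f = f"
  shows "null f"
proof -
  interpret G: comm_group "Hom_group C (Dom C f) (Cod C f)" using assms by (intro Hom_comm_group) auto
  show ?thesis using G.l_cancel_one[of f f] assms
    by (auto simp: Hom_group_def Hom_def null_def)
qed

lemma zero_plus_zero:
  assumes "X \<in> Obj C" "Y \<in> Obj C"
  shows "Plus C (Zero C X Y) (Zero C X Y) = Zero C X Y"
proof -
  interpret G: comm_group "Hom_group C X Y" using assms by (rule Hom_comm_group)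
  show ?thesis using G.l_one[OF G.one_closed] by (simp add: Hom_group_def)
qed

lemma null_comp [simp]:
  assumes "f \<in> Arr C" "g \<in> Arr C" "Cod C f = Dom C g"
  shows "null f \<Longrightarrow> null (g \<cdot> f)" "null g \<Longrightarrow> null (g \<cdot> f)"
proof -
  have f: "f \<in> Hom C (Dom C f) (Cod C f)" and g: "g \<in> Hom C (Cod C f) (Cod C g)"
    using assms by (auto simp: Hom_def)
  have "null f \<Longrightarrow> Plus C f f = f" "null g \<Longrightarrow> Plus C g g = g"
    using assms zero_plus_zero[of "Dom C f" "Cod C f"] zero_plus_zero[of "Dom C g" "Cod C g"]
    by (auto simp: null_def)
  then show "null f \<Longrightarrow> null (g \<cdot> f)" "null g \<Longrightarrow> null (g \<cdot> f)"
    using Comp_Plus_left[OF f g g] Comp_Plus_right[OF f f g] assms by (auto intro!: nullI_idem)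
qed

lemma mono_null: "\<lbrakk>is_mono C f; null (f \<cdot> g); g \<in> Arr C; Cod C g = Dom C f\<rbrakk> \<Longrightarrow> null g"
  using mono_cancel[of f g "Zero C (Dom C g) (Cod C g)"]
    null_unique[of "f \<cdot> g" "f \<cdot> Zero C (Dom C g) (Cod C g)"]
  by (auto simp: null_def[of g])

lemma epi_null: "\<lbrakk>is_epi C f; null (g \<cdot> f); g \<in> Arr C; Dom C g = Cod C f\<rbrakk> \<Longrightarrow> null g"
  using epi_cancel[of f g "Zero C (Dom C g) (Cod C g)"]
    null_unique[of "g \<cdot> f" "Zero C (Dom C g) (Cod C g) \<cdot> f"]
  by (auto simp: null_def[of g])

lemma monoI_null:
  assumes f: "f \<in> Arr C" and null: "\<And>g. \<lbrakk>g \<in> Arr C; Cod C g = Dom C f; null (f \<cdot> g)\<rbrakk> \<Longrightarrow> null g"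
  shows "is_mono C f"
  unfolding is_mono_def
proof (intro conjI ballI impI)
  fix W g h assume W: "W \<in> Obj C" and g: "g \<in> Hom C W (Dom C f)" and h: "h \<in> Hom C W (Dom C f)"
    and eq: "f \<cdot> g = f \<cdot> h"
  interpret G: comm_group "Hom_group C W (Dom C f)" using f W by (intro Hom_comm_group) auto
  note [simp] = Hom_group_def
  \<comment> \<open>\<open>n\<close> is the additive inverse of \<open>h\<close>, so the hypothesis
    is applied to the difference of \<open>g\<close> and \<open>h\<close>.\<close>
  define n where "n = inv\<^bsub>Hom_group C W (Dom C f)\<^esub> h"
  have n: "n \<in> Hom C W (Dom C f)" "Plus C h n = Zero C W (Dom C f)"
    using G.inv_closed[of h] G.r_inv[of h] h by (auto simp: n_def)
  have fh: "f \<in> Hom C (Dom C f) (Cod C f)" using f by (simp add: Hom_def)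
  have "f \<cdot> Plus C g n = f \<cdot> Plus C h n"
    using Comp_Plus_right[OF g n(1) fh] Comp_Plus_right[OF h n(1) fh] eq by simp
  moreover have "null (f \<cdot> Plus C h n)" using n f W by (auto simp: null_comp)
  ultimately have "null (f \<cdot> Plus C g n)" by simp
  moreover have gn: "Plus C g n \<in> Hom C W (Dom C f)" using G.m_closed[of g n] g n by simp
  ultimately have "null (Plus C g n)" using null by (simp add: Hom_def)
  then have "Plus C g n = Plus C h n" using gn n by (simp add: null_def Hom_def)
  then show "g = h" using G.right_cancel[of n g h] g h n by simp
qed (rule f)

lemma mono_if_kernel:
  assumes "is_kernel C f k" shows "is_mono C k"
  unfolding is_mono_def
proof (intro conjI ballI impI)
  fix W a b assume W: "W \<in> Obj C" and ab: "a \<in> Hom C W (Dom C k)" "b \<in> Hom C W (Dom C k)" "k \<cdot> a = k \<cdot> b"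
  have k: "f \<in> Arr C" "k \<in> Arr C" "Cod C k = Dom C f" "null (f \<cdot> k)"
    using assms by (auto simp: is_kernel_def null_def)
  have "f \<cdot> k \<cdot> a = f \<cdot> (k \<cdot> a)" "null (f \<cdot> k \<cdot> a)"
    using ab(1,2) k by (auto simp: Hom_def intro!: comp_assoc)
  then have "f \<cdot> (k \<cdot> a) = Zero C W (Cod C f)" "k \<cdot> a \<in> Hom C W (Dom C f)"
    using k ab by (auto simp: null_def Hom_def)
  then have "\<exists>!u. u \<in> Hom C W (Dom C k) \<and> k \<cdot> u = k \<cdot> a"
    using assms W unfolding is_kernel_def by blast
  then show "a = b" using ab by metis
qed (use assms in \<open>simp add: is_kernel_def\<close>)

lemma epi_if_cokernel:
  assumes "is_cokernel C f c" shows "is_epi C c"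
  unfolding is_epi_def
proof (intro conjI ballI impI)
  fix W a b assume W: "W \<in> Obj C" and ab: "a \<in> Hom C (Cod C c) W" "b \<in> Hom C (Cod C c) W" "a \<cdot> c = b \<cdot> c"
  have c: "f \<in> Arr C" "c \<in> Arr C" "Dom C c = Cod C f" "null (c \<cdot> f)"
    using assms by (auto simp: is_cokernel_def null_def)
  have "a \<cdot> c \<cdot> f = a \<cdot> (c \<cdot> f)" "null (a \<cdot> (c \<cdot> f))"
    using ab(1,2) c by (auto simp: Hom_def intro!: comp_assoc)
  then have "a \<cdot> c \<cdot> f = Zero C (Dom C f) W" "a \<cdot> c \<in> Hom C (Cod C f) W"
    using c ab by (auto simp: null_def Hom_def)
  then have "\<exists>!u. u \<in> Hom C (Cod C c) W \<and> u \<cdot> c = a \<cdot> c"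
    using assms W unfolding is_cokernel_def by blast
  then show "a = b" using ab by metis
qed (use assms in \<open>simp add: is_cokernel_def\<close>)

definition ann where
  "ann q = {h \<in> Arr C. Cod C h = Dom C q \<and> null (q \<cdot> h)}"

text \<open>One inclusion expresses that \<open>q\<close> vanishes on \<open>k\<close>, the other
  the existence of factors, and \<open>k\<close> being mono their uniqueness. Kernels can thus be
  compared as sets.\<close>

lemma kernel_iff: "is_kernel C q k \<longleftrightarrow> q \<in> Arr C \<and> is_mono C k \<and> sieve k = ann q"
proof safe
  assume ker: "is_kernel C q k"
  then show q: "q \<in> Arr C" and "is_mono C k"
    by (auto simp: mono_if_kernel) (auto simp: is_kernel_def)
  have k: "k \<in> Arr C" "Cod C k = Dom C q" "null (q \<cdot> k)"
    using ker by (auto simp: is_kernel_def null_def)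
  {
    fix h assume "h \<in> sieve k"
    then obtain u where "h = k \<cdot> u" "h \<in> Arr C" "Cod C h = Cod C k" "u \<in> Arr C" "Cod C u = Dom C k"
      by (auto simp: sieve_def)
    moreover from this have "q \<cdot> (k \<cdot> u) = q \<cdot> k \<cdot> u" using k q by (simp add: comp_assoc)
    ultimately show "h \<in> ann q" using k q by (simp add: ann_def)
  next
    fix h assume "h \<in> ann q"
    then have h: "h \<in> Arr C" "Cod C h = Dom C q" "q \<cdot> h = Zero C (Dom C h) (Cod C q)"
      using q by (auto simp: ann_def null_def)
    then have "\<exists>!u. u \<in> Hom C (Dom C h) (Dom C k) \<and> k \<cdot> u = h"
      using ker unfolding is_kernel_def by (simp add: Hom_def)
    then show "h \<in> sieve k" using h k by (auto simp: sieve_def Hom_def)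
  }
next
  assume q: "q \<in> Arr C" and k: "is_mono C k" and eq: "sieve k = ann q"
  have "k \<in> ann q" using mem_sieve[of k] k eq by simp
  then have kq: "Cod C k = Dom C q" "null (q \<cdot> k)" by (auto simp: ann_def)
  show "is_kernel C q k" unfolding is_kernel_def
  proof (intro conjI ballI impI)
    show "q \<cdot> k = Zero C (Dom C k) (Cod C q)" using kq k q by (simp add: null_def)
    fix W g assume "W \<in> Obj C" and g: "g \<in> Hom C W (Dom C q)" "q \<cdot> g = Zero C W (Cod C q)"
    then have "g \<in> sieve k" using q unfolding eq by (simp add: ann_def Hom_def null_def)
    then obtain u where "u \<in> Arr C" "Dom C u = Dom C g" "Cod C u = Dom C k" "k \<cdot> u = g" by (rule mem_sieveE)
    then show "\<exists>!u. u \<in> Hom C W (Dom C k) \<and> k \<cdot> u = g"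
      using g k mono_cancel[OF k] by (intro ex1I[of _ u]) (auto simp: Hom_def)
  qed (use q k kq in auto)
qed

text \<open>Cancelling the epimorphism \<open>c\<close> replaces the uniqueness clause, so that
  later only factors have to be constructed.\<close>

lemma cokernel_iff:
  "is_cokernel C f c \<longleftrightarrow> f \<in> Arr C \<and> is_epi C c \<and> Dom C c = Cod C f \<and> null (c \<cdot> f) \<and>
     (\<forall>g\<in>Arr C. Dom C g = Cod C f \<longrightarrow> null (g \<cdot> f) \<longrightarrow>
        (\<exists>u\<in>Arr C. Dom C u = Cod C c \<and> Cod C u = Cod C g \<and> u \<cdot> c = g))"
    (is "?l \<longleftrightarrow> ?r")
proof
  assume l: ?l
  then have "null (c \<cdot> f)" by (auto simp: is_cokernel_def null_def)
  moreover have "\<exists>u\<in>Arr C. Dom C u = Cod C c \<and> Cod C u = Cod C g \<and> u \<cdot> c = g"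
    if g: "g \<in> Arr C" "Dom C g = Cod C f" "null (g \<cdot> f)" for g
  proof -
    have "g \<in> Hom C (Cod C f) (Cod C g)" "g \<cdot> f = Zero C (Dom C f) (Cod C g)" "f \<in> Arr C"
      using g l by (auto simp: Hom_def null_def is_cokernel_def)
    then have "\<exists>!u. u \<in> Hom C (Cod C c) (Cod C g) \<and> u \<cdot> c = g"
      using l g unfolding is_cokernel_def by (metis Cod_Obj)
    then show ?thesis by (auto simp: Hom_def)
  qed
  ultimately show ?r using l epi_if_cokernel[OF l] by (auto simp: is_cokernel_def)
next
  assume ?r
  then have r: "f \<in> Arr C" "is_epi C c" "Dom C c = Cod C f" "null (c \<cdot> f)"
    and univ: "\<And>g. \<lbrakk>g \<in> Arr C; Dom C g = Cod C f; null (g \<cdot> f)\<rbrakk> \<Longrightarrow>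
      \<exists>u\<in>Arr C. Dom C u = Cod C c \<and> Cod C u = Cod C g \<and> u \<cdot> c = g"
    by blast+
  show ?l unfolding is_cokernel_def
  proof (intro conjI ballI impI)
    show "c \<cdot> f = Zero C (Dom C f) (Cod C c)" using r null_def[of "c \<cdot> f"] by simp
    fix W g assume "W \<in> Obj C" and "g \<in> Hom C (Cod C f) W" "g \<cdot> f = Zero C (Dom C f) W"
    moreover from this r have "null (g \<cdot> f)" by (simp add: Hom_def null_def)
    ultimately obtain u where u: "u \<in> Hom C (Cod C c) W" "u \<cdot> c = g"
      using univ[of g] by (auto simp: Hom_def)
    have "v = u" if "v \<in> Hom C (Cod C c) W" "v \<cdot> c = g" for v
      by (rule epi_cancel[OF r(2)]) (use u that in \<open>auto simp: Hom_def\<close>)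
    with u show "\<exists>!u. u \<in> Hom C (Cod C c) W \<and> u \<cdot> c = g" by blast
  qed (use r in auto)
qed

text \<open>Every arrow into or out of \<open>Z\<close> is a composite with the identity of
  \<open>Z\<close>, hence zero once the identity is.\<close>

lemma zero_object_iff: "is_zero_object C Z \<longleftrightarrow> Z \<in> Obj C \<and> null (Ident C Z)"
proof
  assume Z: "is_zero_object C Z"
  then have "Z \<in> Obj C" "\<exists>!f. f \<in> Hom C Z Z" by (auto simp: is_zero_object_def)
  moreover from this have "Ident C Z \<in> Hom C Z Z" "Zero C Z Z \<in> Hom C Z Z" by (auto simp: Hom_def)
  ultimately show "Z \<in> Obj C \<and> null (Ident C Z)" by (auto simp: null_def)
next
  assume Z: "Z \<in> Obj C \<and> null (Ident C Z)"
  have 1: "f = Zero C W Z" if "f \<in> Hom C W Z" for f W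
    using null_comp(2)[of f "Ident C Z"] that Z by (auto simp: Hom_def null_def[of f])
  have 2: "f = Zero C Z W" if "f \<in> Hom C Z W" for f W
    using null_comp(1)[of "Ident C Z" f] that Z by (auto simp: Hom_def null_def[of f])
  show "is_zero_object C Z" unfolding is_zero_object_def
  proof (intro conjI ballI)
    fix W assume "W \<in> Obj C"
    with Z have "Zero C W Z \<in> Hom C W Z" "Zero C Z W \<in> Hom C Z W" by (simp_all add: Hom_def)
    with 1 2 show "\<exists>!f. f \<in> Hom C W Z" "\<exists>!f. f \<in> Hom C Z W" by blast+
  qed (use Z in simp)
qed

end

context abelian_category begin

section \<open>Exactness, images and the two presentations of a subobject\<close>

lemma kernelD:
  assumes "is_kernel C q k"
  shows "q \<in> Arr C" "is_mono C k" "Cod C k = Dom C q" "null (q \<cdot> k)" "sieve k = ann q"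
  using assms mem_sieve[of k] by (auto simp: kernel_iff ann_def)

lemma kernel_factor:
  assumes "is_kernel C q k" "h \<in> Arr C" "Cod C h = Dom C q" "null (q \<cdot> h)"
  obtains u where "u \<in> Arr C" "Dom C u = Dom C h" "Cod C u = Dom C k" "k \<cdot> u = h"
proof -
  have "h \<in> sieve k" using kernelD[OF assms(1)] assms by (simp add: ann_def)
  then show ?thesis using that by (rule mem_sieveE)
qed

lemma cokernelD:
  assumes "is_cokernel C f c"
  shows "f \<in> Arr C" "is_epi C c" "Dom C c = Cod C f" "null (c \<cdot> f)"
  using assms by (auto simp: cokernel_iff)

lemma cokernel_factor:
  assumes "is_cokernel C f c" "g \<in> Arr C" "Dom C g = Cod C f" "null (g \<cdot> f)"
  obtains u where "u \<in> Arr C" "Dom C u = Cod C c" "Cod C u = Cod C g" "u \<cdot> c = g"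
  using assms by (auto simp: cokernel_iff)

text \<open>\<open>k\<close> is a kernel of some \<open>g\<close>, and \<open>g\<close> factors
  through \<open>q\<close>. So whatever \<open>q\<close> kills is killed by \<open>g\<close> and
  factors through \<open>k\<close>.\<close>

lemma kernel_of_cokernel:
  assumes k: "is_mono C k" and q: "is_cokernel C k q"
  shows "is_kernel C q k"
proof -
  note q' = cokernelD[OF q]
  obtain g where g: "is_kernel C g k" using mono_normal k by blast
  note g' = kernelD[OF g]
  obtain u where u: "u \<in> Arr C" "Dom C u = Cod C q" "Cod C u = Cod C g" "u \<cdot> q = g"
    using cokernel_factor[OF q g'(1)] g' by auto
  have "sieve k = ann q"
  proof (intro equalityI subsetI)
    fix h assume "h \<in> sieve k"
    then obtain v where v: "v \<in> Arr C" "Dom C v = Dom C h" "Cod C v = Dom C k" "k \<cdot> v = h"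
      by (rule mem_sieveE)
    have "q \<cdot> k \<cdot> v = q \<cdot> (k \<cdot> v)" "null (q \<cdot> k \<cdot> v)"
      using v q' k by (auto intro!: comp_assoc)
    then show "h \<in> ann q" using v q' k by (auto simp: ann_def)
  next
    fix h assume "h \<in> ann q"
    then have h: "h \<in> Arr C" "Cod C h = Dom C q" "null (q \<cdot> h)" by (auto simp: ann_def)
    have "u \<cdot> q \<cdot> h = u \<cdot> (q \<cdot> h)" using h u q' by (intro comp_assoc) auto
    moreover have "null (u \<cdot> (q \<cdot> h))" using h u q' by auto
    ultimately have "null (g \<cdot> h)" using u by simp
    then show "h \<in> sieve k" unfolding g'(5) using h q' g' by (simp add: ann_def)
  qed
  then show ?thesis using k q' by (simp add: kernel_iff)
qed

text \<open>Dually, \<open>q\<close> is a cokernel of some \<open>g\<close>, and \<open>g\<close>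
  factors through \<open>k\<close>. So an arrow vanishing on \<open>k\<close> vanishes on
  \<open>g\<close> and factors through \<open>q\<close>.\<close>

lemma cokernel_of_kernel:
  assumes q: "is_epi C q" and k: "is_kernel C q k"
  shows "is_cokernel C k q"
  unfolding cokernel_iff
proof (intro conjI ballI impI)
  note k' = kernelD[OF k]
  show "k \<in> Arr C" "is_epi C q" "Dom C q = Cod C k" "null (q \<cdot> k)" using k' q by auto
  fix h assume h: "h \<in> Arr C" "Dom C h = Cod C k" "null (h \<cdot> k)"
  obtain g where g: "is_cokernel C g q" using epi_normal q by blast
  note g' = cokernelD[OF g]
  obtain u where u: "u \<in> Arr C" "Dom C u = Dom C g" "Cod C u = Dom C k" "k \<cdot> u = g"
    using kernel_factor[OF k g'(1)] g' by auto
  have "h \<cdot> k \<cdot> u = h \<cdot> (k \<cdot> u)" using h u k' by (intro comp_assoc) auto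
  moreover have "null (h \<cdot> k \<cdot> u)" using h u k' by auto
  ultimately have "null (h \<cdot> g)" using u by simp
  then obtain v where "v \<in> Arr C" "Dom C v = Cod C q" "Cod C v = Cod C h" "v \<cdot> q = h"
    using cokernel_factor[OF g, of h] h k' g' by auto
  then show "\<exists>u\<in>Arr C. Dom C u = Cod C q \<and> Cod C u = Cod C h \<and> u \<cdot> q = h" by blast
qed

lemma image_factorization:
  assumes k: "is_kernel C f k" and e: "is_cokernel C k e"
  obtains m where "is_mono C m" "Dom C m = Cod C e" "Cod C m = Cod C f" "m \<cdot> e = f"
proof -
  note k' = kernelD[OF k] and e' = cokernelD[OF e]
  obtain m where m: "m \<in> Arr C" "Dom C m = Cod C e" "Cod C m = Cod C f" "m \<cdot> e = f"
    using cokernel_factor[OF e k'(1)] k' by auto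
  have "is_mono C m"
  proof (rule monoI_null[OF m(1)])
    fix g assume g: "g \<in> Arr C" "Cod C g = Dom C m" "null (m \<cdot> g)"
    \<comment> \<open>As \<open>m\<close> vanishes on \<open>g\<close>, it factors through the
      cokernel \<open>q\<close> of \<open>g\<close>. Hence \<open>f\<close> vanishes on the arrow
      \<open>h\<close> of which \<open>q \<cdot> e\<close> is a cokernel, and so does
      \<open>e\<close>. Thus \<open>e\<close> factors through \<open>q \<cdot> e\<close>, which
      gives \<open>q\<close> a left inverse \<open>w\<close>, and
      \<open>g = w \<cdot> (q \<cdot> g)\<close> is zero.\<close>
    obtain q where q: "is_cokernel C g q" using cokernels g by blast
    note q' = cokernelD[OF q]
    obtain m' where m': "m' \<in> Arr C" "Dom C m' = Cod C q" "Cod C m' = Cod C m" "m' \<cdot> q = m"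
      using cokernel_factor[OF q m(1)] g by auto
    have qe: "is_epi C (q \<cdot> e)" using q' e' m g by (intro epi_comp) auto
    obtain h where h: "is_cokernel C h (q \<cdot> e)" using epi_normal qe by blast
    note h' = cokernelD[OF h]
    have hd: "Cod C h = Dom C e" "h \<in> Arr C" using h' q' e' m g by auto
    have "m' \<cdot> q \<cdot> e = m' \<cdot> (q \<cdot> e)" using m' q' e' m g by (intro comp_assoc) auto
    then have "f = m' \<cdot> (q \<cdot> e)" using m' m by simp
    moreover have "m' \<cdot> (q \<cdot> e) \<cdot> h = m' \<cdot> (q \<cdot> e \<cdot> h)"
      using m(1-3) m'(1-3) q' e' hd g by (intro comp_assoc) auto
    ultimately have "f \<cdot> h = m' \<cdot> (q \<cdot> e \<cdot> h)" by simp
    moreover have "null (m' \<cdot> (q \<cdot> e \<cdot> h))"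
      by (rule null_comp(1)) (use m(1-3) m'(1-3) q' e' hd h'(4) g in auto)
    ultimately have "null (f \<cdot> h)" by simp
    then obtain l where l: "l \<in> Arr C" "Dom C l = Dom C h" "Cod C l = Dom C k" "k \<cdot> l = h"
      using kernel_factor[OF k, of h] hd e' k' by auto
    have "e \<cdot> k \<cdot> l = e \<cdot> (k \<cdot> l)" using l e' k' by (intro comp_assoc) auto
    moreover have "null (e \<cdot> k \<cdot> l)" using l e' k' by auto
    ultimately have "null (e \<cdot> h)" using l by simp
    then obtain w where w: "w \<in> Arr C" "Dom C w = Cod C (q \<cdot> e)" "Cod C w = Cod C e" "w \<cdot> (q \<cdot> e) = e"
      using cokernel_factor[OF h, of e] hd e' by auto
    have "w \<cdot> q \<cdot> e = w \<cdot> (q \<cdot> e)" using w(1,2,3) q' e' m(1-3) g by (intro comp_assoc) auto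
    then have "w \<cdot> q \<cdot> e = Ident C (Cod C e) \<cdot> e" using w e' by simp
    then have "w \<cdot> q = Ident C (Cod C e)"
      by (rule epi_cancel[OF e'(2)]) (use w(1,2,3) q' e' m(1-3) g in simp_all)
    then have "w \<cdot> q \<cdot> g = g" using g m by simp
    moreover have "w \<cdot> q \<cdot> g = w \<cdot> (q \<cdot> g)" using w(1,2,3) q' e' m(1-3) g by (intro comp_assoc) auto
    moreover have "null (w \<cdot> (q \<cdot> g))" by (rule null_comp(1)) (use w(1,2,3) q' e' m(1-3) g in auto)
    ultimately show "null g" by simp
  qed
  with m that show ?thesis by blast
qed

text \<open>As \<open>e\<close> is epi, the same arrows vanish on \<open>m\<close> and on
  \<open>m \<cdot> e\<close>.\<close>

lemma cokernel_precomp_epi: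
  assumes "is_epi C e" "m \<in> Arr C" "Cod C e = Dom C m" "is_cokernel C (m \<cdot> e) d"
  shows "is_cokernel C m d"
  unfolding cokernel_iff
proof (intro conjI ballI impI)
  note d' = cokernelD[OF assms(4)]
  show "m \<in> Arr C" "is_epi C d" "Dom C d = Cod C m" using d' assms by auto
  have "d \<cdot> m \<cdot> e = d \<cdot> (m \<cdot> e)" using assms d' by (intro comp_assoc) auto
  then show "null (d \<cdot> m)" using d' assms epi_null[OF assms(1), of "d \<cdot> m"] by auto
  fix g assume g: "g \<in> Arr C" "Dom C g = Cod C m" "null (g \<cdot> m)"
  have "g \<cdot> m \<cdot> e = g \<cdot> (m \<cdot> e)" using assms g by (intro comp_assoc) auto
  moreover have "null (g \<cdot> m \<cdot> e)" using g assms by auto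
  ultimately obtain u where "u \<in> Arr C" "Dom C u = Cod C d" "Cod C u = Cod C g" "u \<cdot> d = g"
    using cokernel_factor[OF assms(4), of g] g assms by auto
  then show "\<exists>u\<in>Arr C. Dom C u = Cod C d \<and> Cod C u = Cod C g \<and> u \<cdot> d = g" by blast
qed

lemma sieves_ann:
  assumes "q \<in> Arr C" shows "ann q \<in> sieves (Dom C q)"
proof -
  obtain k where "is_kernel C q k" using kernels assms by blast
  from kernelD(2,3,5)[OF this] show ?thesis by (auto simp: sieves_def)
qed

text \<open>A subobject is given by a monomorphism or by its quotient, each determining the other;
  later arguments pick the form that composes.\<close>

lemma sievesE:
  assumes "V \<in> sieves X"
  obtains k q where "is_mono C k" "Cod C k = X" "V = sieve k" "is_epi C q" "Dom C q = X"
    "V = ann q" "is_kernel C q k" "is_cokernel C k q"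
proof -
  obtain k where k: "is_mono C k" "Cod C k = X" "V = sieve k" using assms by (auto simp: sieves_def)
  obtain q where q: "is_cokernel C k q" using cokernels k mono_arr by blast
  show ?thesis
    using that[of k q] k q kernel_of_cokernel[OF k(1) q] cokernelD[OF q] kernelD(5)[of q k] by auto
qed

lemma ann_comp_subset: "\<lbrakk>q \<in> Arr C; u \<in> Arr C; Cod C q = Dom C u\<rbrakk> \<Longrightarrow> ann q \<subseteq> ann (u \<cdot> q)"
  by (auto simp: ann_def comp_assoc)

text \<open>The epimorphism \<open>q\<close> is a cokernel of its kernel, and \<open>r\<close>
  vanishes on that kernel.\<close>

lemma ann_subset_imp_factor:
  assumes "is_epi C q" "r \<in> Arr C" "Dom C r = Dom C q" "ann q \<subseteq> ann r"
  obtains u where "u \<in> Arr C" "Dom C u = Cod C q" "Cod C u = Cod C r" "u \<cdot> q = r"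
proof -
  obtain k where k: "is_kernel C q k" using kernels assms epi_arr by blast
  have "k \<in> ann q" using kernelD[OF k] mem_sieve[of k] by auto
  then have "null (r \<cdot> k)" "Cod C k = Dom C q" using assms by (auto simp: ann_def)
  then show ?thesis
    using cokernel_factor[OF cokernel_of_kernel[OF assms(1) k] assms(2)] assms that by auto
qed

text \<open>This computes meets: the intersection of S with the kernel T of \<open>q\<close> is the
  kernel of the composite from S to X/T.\<close>

lemma sieve_comp:
  assumes "is_mono C s" "is_kernel C (q \<cdot> s) k" "q \<in> Arr C" "Cod C s = Dom C q"
  shows "sieve (s \<cdot> k) = sieve s \<inter> ann q"
proof (intro equalityI subsetI)
  note k' = kernelD[OF assms(2)]
  have k: "Cod C k = Dom C s" "k \<in> Arr C" using k' assms by auto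
  fix h
  {
    assume "h \<in> sieve (s \<cdot> k)"
    then obtain u where u: "u \<in> Arr C" "Dom C u = Dom C h" "Cod C u = Dom C (s \<cdot> k)" "s \<cdot> k \<cdot> u = h"
      by (rule mem_sieveE)
    have uk: "Cod C u = Dom C k" using u(3) k assms(1,3,4) by simp
    have h: "h = s \<cdot> (k \<cdot> u)" unfolding u(4)[symmetric]
      by (rule comp_assoc) (use u(1) uk k assms in auto)
    then have "h \<in> sieve s" using mem_sieveI[of s "k \<cdot> u"] u(1) uk k assms(1) by simp
    moreover have "q \<cdot> h = q \<cdot> s \<cdot> k \<cdot> u"
      unfolding h using u(1) uk k assms(1,3,4) by (simp add: comp_assoc)
    moreover have "null (q \<cdot> s \<cdot> k \<cdot> u)"
      by (rule null_comp(2)) (use k'(4) u(1) uk k assms(1,3,4) in auto)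
    ultimately show "h \<in> sieve s \<inter> ann q"
      using u(1) uk k assms(1,3,4) by (simp add: ann_def h)
  next
    assume h: "h \<in> sieve s \<inter> ann q"
    then obtain u where u: "u \<in> Arr C" "Dom C u = Dom C h" "Cod C u = Dom C s" "s \<cdot> u = h"
      by (meson IntD1 mem_sieveE)
    have "q \<cdot> s \<cdot> u = q \<cdot> (s \<cdot> u)" using u(1,3) assms(1,3,4) by (intro comp_assoc) auto
    then have "null (q \<cdot> s \<cdot> u)" using h u(4) by (simp add: ann_def)
    then obtain v where v: "v \<in> Arr C" "Dom C v = Dom C u" "Cod C v = Dom C k" "k \<cdot> v = u"
      using kernel_factor[OF assms(2) u(1)] u(3) assms(1,3,4) by auto
    have "s \<cdot> k \<cdot> v = s \<cdot> (k \<cdot> v)" using v(1,3) k assms(1,4) by (intro comp_assoc) auto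
    then have "h = s \<cdot> k \<cdot> v" using u(4) v(4) by simp
    then show "h \<in> sieve (s \<cdot> k)" using mem_sieveI[of "s \<cdot> k" v] v(1,3) k assms(1) by simp
  }
qed

end

section \<open>Classes in the Grothendieck group\<close>

locale Grothendieck_quotient = abelian_category +
  fixes N assumes N: "subgroup N (K0 C)"
begin

abbreviation "G \<equiv> K_group C N"
abbreviation "cls \<equiv> K_class C N"

section \<open>Additivity of classes on short exact sequences\<close>

lemma K0_relations_normal: "K0_relations C \<lhd> free_Abelian_group (Obj C)"
proof -
  let ?F = "free_Abelian_group (Obj C)"
  interpret F: comm_group "free_Abelian_group (Obj C)" by (rule abelian_free_Abelian_group)
  have "subgroup (K0_relations C) ?F" unfolding K0_relations_def
  proof (rule F.generate_is_subgroup)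
    show "{frag_of (Cod C f) - frag_of (Dom C f) - frag_of (Cod C g) |f g. short_exact C f g} \<subseteq> carrier ?F"
    proof clarify
      fix f g assume "short_exact C f g"
      then have "f \<in> Arr C" "g \<in> Arr C" by (auto simp: short_exact_def is_kernel_def)
      then have "{Cod C f, Dom C f, Cod C g} \<subseteq> Obj C" by simp
      moreover have "Poly_Mapping.keys (frag_of (Cod C f) - frag_of (Dom C f) - frag_of (Cod C g))
          \<subseteq> {Cod C f, Dom C f, Cod C g}"
        using keys_diff[of "frag_of (Cod C f) - frag_of (Dom C f)" "frag_of (Cod C g)"]
          keys_diff[of "frag_of (Cod C f)" "frag_of (Dom C f)"] by auto
      ultimately show "frag_of (Cod C f) - frag_of (Dom C f) - frag_of (Cod C g) \<in> carrier ?F"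
        by auto
    qed
  qed
  then show ?thesis by (rule F.subgroup_imp_normal)
qed

lemma comm_group_K0: "comm_group (K0 C)"
  unfolding K0_def using K0_relations_normal abelian_free_Abelian_group
  by (intro comm_group.abelian_FactGroup normal_imp_subgroup)

lemma N_normal: "N \<lhd> K0 C"
  using comm_group_K0 N by (rule comm_group.normal_iff_subgroup[THEN iffD2])

lemma comm_group_G: "comm_group G"
  unfolding K_group_def using comm_group_K0 N by (intro comm_group.abelian_FactGroup)

sublocale G: comm_group G by (rule comm_group_G)

lemma K0_class_closed: "X \<in> Obj C \<Longrightarrow> K0_class C X \<in> carrier (K0 C)"
  by (simp add: K0_def K0_class_def carrier_FactGroup)

lemma cls_closed [simp]: "X \<in> Obj C \<Longrightarrow> cls X \<in> carrier G"
  using K0_class_closed by (auto simp: K_group_def K_class_def carrier_FactGroup)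

lemma K0_class_exact:
  assumes "short_exact C f g"
  shows "K0_class C (Cod C f) = K0_class C (Dom C f) \<otimes>\<^bsub>K0 C\<^esub> K0_class C (Cod C g)"
proof -
  let ?F = "free_Abelian_group (Obj C)" and ?R = "K0_relations C"
  interpret R: normal ?R ?F by (rule K0_relations_normal)
  have fg: "f \<in> Arr C" "g \<in> Arr C" using assms by (auto simp: short_exact_def is_kernel_def)
  define a b c where "a = frag_of (Dom C f)" "b = frag_of (Cod C f)" "c = frag_of (Cod C g)"
  have abc: "a \<in> carrier ?F" "b \<in> carrier ?F" "c \<in> carrier ?F"
    using fg by (auto simp: a_b_c_def)
  \<comment> \<open>\<open>b - a - c\<close> is one of the generating relations, so \<open>b\<close>
    and \<open>a + c\<close> lie in the same coset.\<close>
  have r: "b - a - c \<in> ?R"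
    unfolding K0_relations_def a_b_c_def by (rule generate.incl) (use assms in blast)
  have "b \<in> ?R #>\<^bsub>?F\<^esub> (a + c)"
    unfolding r_coset_def using r by (auto intro!: bexI[of _ "b - a - c"])
  moreover have ac: "a + c \<in> carrier ?F" using R.m_closed[OF abc(1,3)] by simp
  ultimately have "?R #>\<^bsub>?F\<^esub> b = ?R #>\<^bsub>?F\<^esub> (a + c)"
    using R.repr_independence[OF _ ac R.is_subgroup] by simp
  also have "\<dots> = (?R #>\<^bsub>?F\<^esub> a) <#>\<^bsub>?F\<^esub> (?R #>\<^bsub>?F\<^esub> c)"
    using R.rcos_sum[OF abc(1,3)] by simp
  finally show ?thesis by (simp add: K0_def K0_class_def a_b_c_def)
qed

lemma cls_exact:
  assumes "short_exact C f g"
  shows "cls (Cod C f) = cls (Dom C f) \<otimes>\<^bsub>G\<^esub> cls (Cod C g)"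
proof -
  interpret N: normal N "K0 C" by (rule N_normal)
  have "f \<in> Arr C" "g \<in> Arr C" using assms by (auto simp: short_exact_def is_kernel_def)
  then show ?thesis
    by (simp add: K_class_def K0_class_exact[OF assms] K_group_def N.rcos_sum K0_class_closed)
qed

lemma cls_mono: "\<lbrakk>is_mono C k; is_cokernel C k q\<rbrakk> \<Longrightarrow> cls (Cod C k) = cls (Dom C k) \<otimes>\<^bsub>G\<^esub> cls (Cod C q)"
  by (simp add: cls_exact short_exact_def kernel_of_cokernel)

lemma cls_epi: "\<lbrakk>is_epi C q; is_kernel C q k\<rbrakk> \<Longrightarrow> cls (Dom C q) = cls (Dom C k) \<otimes>\<^bsub>G\<^esub> cls (Cod C q)"
  using cls_exact[of k q] cokernel_of_kernel[of q k] kernelD(3)[of q k]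
  by (simp add: short_exact_def)

end

lemma (in comm_group) mult_inv_cancel:
  assumes "a \<in> carrier G" "c \<in> carrier G" shows "a \<otimes> c \<otimes> inv a = c"
  using assms by (simp add: m_comm[of a c] m_assoc)

context Grothendieck_quotient begin

section \<open>Classes of sieves, and the two extreme subobjects\<close>

definition sieve_cls where
  "sieve_cls V = cls (Dom C (SOME k. is_mono C k \<and> sieve k = V))"

text \<open>The class of T/S, written as a difference so that no quotient object has to be
  chosen.\<close>

definition sdiff where
  "sdiff S T = sieve_cls T \<otimes>\<^bsub>G\<^esub> inv\<^bsub>G\<^esub> sieve_cls S"

definition top_sieve where "top_sieve X = sieve (Ident C X)"

text \<open>The kernel of the identity, that is, the zero subobject.\<close>

definition bot_sieve where "bot_sieve X = ann (Ident C X)"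

text \<open>Monomorphisms with the same sieve are kernels of the same \<open>q\<close>, so
  additivity and cancellation give their domains the same class.\<close>

lemma sieve_cls: assumes "is_mono C k" shows "sieve_cls (sieve k) = cls (Dom C k)"
proof -
  define k' where "k' = (SOME k'. is_mono C k' \<and> sieve k' = sieve k)"
  have "is_mono C k' \<and> sieve k' = sieve k"
    unfolding k'_def by (rule someI[of _ k]) (use assms in simp)
  moreover obtain q where q: "is_cokernel C k q" using cokernels assms mono_arr by blast
  ultimately have "is_kernel C q k" "is_kernel C q k'"
    using kernel_of_cokernel[OF assms q] by (simp_all add: kernel_iff)
  moreover note cokernelD(2)[OF q]
  ultimately have "cls (Dom C k) \<otimes>\<^bsub>G\<^esub> cls (Cod C q) = cls (Dom C k') \<otimes>\<^bsub>G\<^esub> cls (Cod C q)"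
    and "is_mono C k'"
    using cls_epi[of q k] cls_epi[of q k'] kernelD(2) by auto
  then have "cls (Dom C k) = cls (Dom C k')"
    using assms cokernelD(2)[OF q] by (subst (asm) G.right_cancel) auto
  then show ?thesis by (simp add: sieve_cls_def k'_def)
qed

lemma sieve_cls_closed [simp]: "V \<in> sieves X \<Longrightarrow> sieve_cls V \<in> carrier G"
  by (auto simp: sieves_def sieve_cls)

lemma cls_ann: assumes "is_epi C q" shows "cls (Dom C q) = sieve_cls (ann q) \<otimes>\<^bsub>G\<^esub> cls (Cod C q)"
proof -
  obtain k where k: "is_kernel C q k" using kernels assms epi_arr by blast
  show ?thesis using cls_epi[OF assms k] sieve_cls[OF kernelD(2)[OF k]] kernelD(5)[OF k] by simp
qed

lemma top_sieve_eq: "X \<in> Obj C \<Longrightarrow> top_sieve X = {h \<in> Arr C. Cod C h = X}"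
  unfolding top_sieve_def by (force simp: sieve_def)

lemma bot_sieve_eq: "X \<in> Obj C \<Longrightarrow> bot_sieve X = {h \<in> Arr C. Cod C h = X \<and> null h}"
  unfolding bot_sieve_def by (auto simp: ann_def)

lemma mono_ident: "X \<in> Obj C \<Longrightarrow> is_mono C (Ident C X)"
  by (rule monoI_null) auto

lemma top_sieve_mem: "X \<in> Obj C \<Longrightarrow> top_sieve X \<in> sieves X"
  unfolding top_sieve_def sieves_def using mono_ident[of X] by auto

lemma bot_sieve_mem: "X \<in> Obj C \<Longrightarrow> bot_sieve X \<in> sieves X"
  unfolding bot_sieve_def using sieves_ann[of "Ident C X"] by auto

lemma sieves_le_top: "\<lbrakk>X \<in> Obj C; V \<in> sieves X\<rbrakk> \<Longrightarrow> V \<subseteq> top_sieve X"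
  by (auto simp: sieves_def top_sieve_eq sieve_def)

lemma bot_le_sieves:
  assumes "X \<in> Obj C" "V \<in> sieves X" shows "bot_sieve X \<subseteq> V"
proof -
  obtain q where q: "V = ann q" "is_epi C q" "Dom C q = X" using assms(2) by (rule sievesE)
  then show ?thesis using assms(1) by (auto simp: ann_def bot_sieve_eq)
qed

lemma zero_object_iff_sieves: "X \<in> Obj C \<Longrightarrow> is_zero_object C X \<longleftrightarrow> bot_sieve X = top_sieve X"
proof
  assume X: "X \<in> Obj C" and "is_zero_object C X"
  then have I: "null (Ident C X)" by (simp add: zero_object_iff)
  have "null h" if h: "h \<in> Arr C" "Cod C h = X" for h
    using null_comp(2)[of h "Ident C X"] h X I by simp
  then show "bot_sieve X = top_sieve X" using X by (auto simp: top_sieve_eq bot_sieve_eq)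
next
  assume X: "X \<in> Obj C" and eq: "bot_sieve X = top_sieve X"
  have "Ident C X \<in> bot_sieve X" unfolding eq using X by (simp add: top_sieve_eq)
  then show "is_zero_object C X" using X by (simp add: zero_object_iff bot_sieve_eq)
qed

lemma sieve_of_whole: "X \<in> Obj C \<Longrightarrow> whole_subobject C X \<in> subobjects C X \<and>
    sieve_of (whole_subobject C X) = top_sieve X"
proof -
  assume X: "X \<in> Obj C"
  note m = mono_ident[OF X]
  have "whole_subobject C X \<in> subobjects C X"
    unfolding whole_subobject_def subobjects_def using m X by auto
  moreover have "Ident C X \<in> whole_subobject C X"
    unfolding whole_subobject_def subobject_of_eq[OF m] using m by simp
  ultimately show ?thesis using sieve_of_mem(2) unfolding top_sieve_def by metis
qed

text \<open>A monomorphism is zero exactly when the identity of its domain is, and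
  \<open>bot_sieve X\<close> consists of the zero arrows into \<open>X\<close>.\<close>

lemma zero_subobject_eq:
  assumes "X \<in> Obj C"
  shows "zero_subobject C X = {i. is_mono C i \<and> sieve i = bot_sieve X}"
proof (intro equalityI subsetI)
  fix i assume "i \<in> zero_subobject C X"
  then have i: "is_mono C i" "Cod C i = X" "null (Ident C (Dom C i))"
    by (auto simp: zero_subobject_def zero_object_iff)
  then have "null i" using null_comp(1)[of "Ident C (Dom C i)" i] by simp
  then have "i \<in> bot_sieve X" using i assms by (simp add: bot_sieve_eq)
  obtain b where b: "is_mono C b" "bot_sieve X = sieve b" "Cod C b = X"
    using bot_sieve_mem[OF assms] by (auto simp: sieves_def)
  then have "sieve i \<subseteq> bot_sieve X" using \<open>i \<in> bot_sieve X\<close> sieve_subset_iff[of i b] i by simp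
  moreover have "bot_sieve X \<subseteq> sieve i"
    using bot_le_sieves[OF assms, of "sieve i"] i by (auto simp: sieves_def)
  ultimately show "i \<in> {i. is_mono C i \<and> sieve i = bot_sieve X}" using i by simp
next
  fix i assume "i \<in> {i. is_mono C i \<and> sieve i = bot_sieve X}"
  then have i: "is_mono C i" "sieve i = bot_sieve X" by auto
  then have "i \<in> bot_sieve X" using mem_sieve[of i] by simp
  then have n: "null i" "Cod C i = X" using assms by (auto simp: bot_sieve_eq)
  have "null (i \<cdot> Ident C (Dom C i))" using n i by simp
  then have "null (Ident C (Dom C i))" by (rule mono_null[OF i(1)]) (use i in auto)
  then show "i \<in> zero_subobject C X" using i n by (simp add: zero_subobject_def zero_object_iff)
qed

lemma sieve_of_zero: "X \<in> Obj C \<Longrightarrow> zero_subobject C X \<in> subobjects C X \<and>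
    sieve_of (zero_subobject C X) = bot_sieve X"
proof -
  assume X: "X \<in> Obj C"
  obtain b where b: "is_mono C b" "bot_sieve X = sieve b" "Cod C b = X"
    using bot_sieve_mem[OF X] by (auto simp: sieves_def)
  have eq: "zero_subobject C X = subobject_of C b"
    using zero_subobject_eq[OF X] subobject_of_eq[OF b(1)] b(2) by simp
  have "zero_subobject C X \<in> subobjects C X" unfolding eq subobjects_def using b by auto
  moreover have "b \<in> zero_subobject C X" using zero_subobject_eq[OF X] b by simp
  ultimately show ?thesis using sieve_of_mem(2) b(2) by metis
qed

lemma cls_subobject_dom:
  assumes "S \<in> subobjects C X" shows "cls (subobject_dom C S) = sieve_cls (sieve_of S)"
proof -
  have "(SOME s. s \<in> S) \<in> S" using subobject_nonempty[OF assms] by (rule someI_ex)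
  from sieve_of_mem(1)[OF assms this] show ?thesis
    by (simp add: sieve_of_def sieve_cls subobject_dom_def)
qed

text \<open>With S given by a monomorphism \<open>s\<close> and T by its quotient \<open>q\<close>,
  everything is read off the arrow \<open>q \<cdot> s\<close> from S to X/T: its kernel gives the
  meet, its image is \<open>S/(S \<inter> T)\<close>, and its cokernel is the quotient of X by the
  join.\<close>

lemma sieves_Int_join:
  assumes "S \<in> sieves X" "T \<in> sieves X"
  shows "S \<inter> T \<in> sieves X" "\<exists>J\<in>sieves X. S \<subseteq> J \<and> T \<subseteq> J \<and>
    (\<forall>R\<in>sieves X. S \<subseteq> R \<longrightarrow> T \<subseteq> R \<longrightarrow> J \<subseteq> R) \<and> sdiff (S \<inter> T) S = sdiff T J"
proof -
  obtain s where s: "is_mono C s" "Cod C s = X" "S = sieve s" using assms(1) by (rule sievesE)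
  obtain q where q: "is_epi C q" "Dom C q = X" "T = ann q" using assms(2) by (rule sievesE)
  have qs: "q \<cdot> s \<in> Arr C" "Dom C (q \<cdot> s) = Dom C s" "Cod C (q \<cdot> s) = Cod C q" using q s by auto
  obtain k where k: "is_kernel C (q \<cdot> s) k" using kernels qs by blast
  have k': "is_mono C k" "Cod C k = Dom C s" using kernelD[OF k] qs by auto
  have Int: "sieve (s \<cdot> k) = S \<inter> T" unfolding s(3) q(3) by (rule sieve_comp) (use s q k in auto)
  have sk: "is_mono C (s \<cdot> k)" using k' s by (intro mono_comp) auto
  show ST: "S \<inter> T \<in> sieves X" unfolding sieves_def Int[symmetric] using sk s k' by auto
  obtain e where e: "is_cokernel C k e" using cokernels k' mono_arr by blast
  note e' = cokernelD[OF e]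
  obtain m where m: "is_mono C m" "Dom C m = Cod C e" "Cod C m = Cod C (q \<cdot> s)" "m \<cdot> e = q \<cdot> s"
    using image_factorization[OF k e] .
  obtain d where d: "is_cokernel C (q \<cdot> s) d" using cokernels qs by blast
  \<comment> \<open>The cokernel of \<open>q \<cdot> s\<close> is also that of its image
    \<open>m\<close>, so the class of X/T is the sum of the classes of image and cokernel.\<close>
  have md: "is_cokernel C m d"
    by (rule cokernel_precomp_epi[OF e'(2)]) (use m d in auto)
  have d': "is_epi C d" "Dom C d = Cod C q" "null (d \<cdot> (q \<cdot> s))" using cokernelD[OF d] qs by auto
  have dq: "is_epi C (d \<cdot> q)" "Dom C (d \<cdot> q) = X" "Cod C (d \<cdot> q) = Cod C d"
    using d' q by (auto intro: epi_comp)
  let ?J = "ann (d \<cdot> q)"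
  have J: "?J \<in> sieves X" using sieves_ann[of "d \<cdot> q"] dq by simp
  obtain j where j: "?J = sieve j" "is_mono C j" "Cod C j = X" using J by (rule sievesE)
  have "d \<cdot> q \<cdot> s = d \<cdot> (q \<cdot> s)" using d' q s by (intro comp_assoc) auto
  then have "s \<in> ?J" using d' s dq by (simp add: ann_def)
  then have SJ: "S \<subseteq> ?J" using sieve_subset_iff[of s j] j s by simp
  have TJ: "T \<subseteq> ?J" unfolding q(3) using ann_comp_subset d' q by simp
  \<comment> \<open>If \<open>r\<close> is the quotient by an upper bound \<open>R\<close>, then
    \<open>T \<subseteq> R\<close> factors \<open>r\<close> as \<open>u \<cdot> q\<close>, and
    \<open>S \<subseteq> R\<close> makes \<open>u\<close> vanish on \<open>q \<cdot> s\<close>. So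
    \<open>u\<close> factors through \<open>d\<close>, and \<open>r\<close> through
    \<open>d \<cdot> q\<close>.\<close>
  have least: "?J \<subseteq> R" if R: "R \<in> sieves X" "S \<subseteq> R" "T \<subseteq> R" for R
  proof -
    obtain r where r: "is_epi C r" "Dom C r = X" "R = ann r" using R(1) by (rule sievesE)
    obtain u where u: "u \<in> Arr C" "Dom C u = Cod C q" "Cod C u = Cod C r" "u \<cdot> q = r"
      using ann_subset_imp_factor[OF q(1), of r] r q R by auto
    have "s \<in> R" using R(2) s mem_sieve[of s] by auto
    then have "null (u \<cdot> q \<cdot> s)" using r u by (simp add: ann_def)
    moreover have "u \<cdot> q \<cdot> s = u \<cdot> (q \<cdot> s)" using u(1,2) q s by (intro comp_assoc) auto
    ultimately obtain v where v: "v \<in> Arr C" "Dom C v = Cod C d" "Cod C v = Cod C u" "v \<cdot> d = u"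
      using cokernel_factor[OF d u(1)] u(2) qs by auto
    have "v \<cdot> d \<cdot> q = v \<cdot> (d \<cdot> q)" using v(1,2) d' q by (intro comp_assoc) auto
    then have "r = v \<cdot> (d \<cdot> q)" using u v by simp
    then show ?thesis unfolding r(3) using ann_comp_subset[of "d \<cdot> q" v] dq v(1,2) by simp
  qed
  \<comment> \<open>Writing I and D for the codomains of \<open>e\<close> and \<open>d\<close>,
    additivity gives [S] = [S \<inter> T] + [I], [X] = [T] + [I] + [D] and [X] = [J] + [D].
    Cancelling [D] leaves [J] = [T] + [I].\<close>
  have "cls (Dom C s) = cls (Dom C k) \<otimes>\<^bsub>G\<^esub> cls (Cod C e)"
    using cls_mono[OF k'(1) e] k' by simp
  then have 1: "sieve_cls S = sieve_cls (S \<inter> T) \<otimes>\<^bsub>G\<^esub> cls (Cod C e)"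
    using sieve_cls[OF sk] sieve_cls[OF s(1)] s k' by (simp add: Int)
  have "cls X = sieve_cls T \<otimes>\<^bsub>G\<^esub> cls (Cod C q)" using cls_ann[OF q(1)] q by simp
  also have "cls (Cod C q) = cls (Cod C e) \<otimes>\<^bsub>G\<^esub> cls (Cod C d)" using cls_mono[OF m(1) md] m qs by simp
  finally have 2: "cls X = sieve_cls T \<otimes>\<^bsub>G\<^esub> (cls (Cod C e) \<otimes>\<^bsub>G\<^esub> cls (Cod C d))" .
  have 3: "cls X = sieve_cls ?J \<otimes>\<^bsub>G\<^esub> cls (Cod C d)" using cls_ann[OF dq(1)] dq by simp
  note closed = sieve_cls_closed[OF assms(1)] sieve_cls_closed[OF assms(2)] sieve_cls_closed[OF ST]
    sieve_cls_closed[OF J]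
  have c: "cls (Cod C e) \<in> carrier G" "cls (Cod C d) \<in> carrier G" using e' d' by auto
  have "sieve_cls T \<otimes>\<^bsub>G\<^esub> cls (Cod C e) \<otimes>\<^bsub>G\<^esub> cls (Cod C d) = sieve_cls ?J \<otimes>\<^bsub>G\<^esub> cls (Cod C d)"
    using 2 3 closed c by (simp add: G.m_assoc)
  then have "sieve_cls ?J = sieve_cls T \<otimes>\<^bsub>G\<^esub> cls (Cod C e)"
    using closed c by (subst (asm) G.right_cancel) auto
  then have "sdiff T ?J = cls (Cod C e)" "sdiff (S \<inter> T) S = cls (Cod C e)"
    unfolding sdiff_def 1 using closed c by (simp_all only: G.mult_inv_cancel)
  with J SJ TJ least show "\<exists>J\<in>sieves X. S \<subseteq> J \<and> T \<subseteq> J \<and>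
    (\<forall>R\<in>sieves X. S \<subseteq> R \<longrightarrow> T \<subseteq> R \<longrightarrow> J \<subseteq> R) \<and> sdiff (S \<inter> T) S = sdiff T J"
    by (intro bexI[of _ ?J]) auto
qed

text \<open>A relation instead of a chosen object: it covers any cokernel of an inclusion of
  representatives, in particular the one picked by \<open>subquotient\<close>.\<close>

definition is_quotient where
  "is_quotient S T Q \<longleftrightarrow> (\<exists>t f c. is_mono C t \<and> f \<in> Arr C \<and> Cod C f = Dom C t \<and>
     is_mono C (t \<cdot> f) \<and> sieve t = T \<and> sieve (t \<cdot> f) = S \<and> is_cokernel C f c \<and> Q = Cod C c)"

lemma quotient_exists:
  assumes "S \<in> sieves X" "T \<in> sieves X" "S \<subseteq> T" shows "\<exists>Q. is_quotient S T Q"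
proof -
  obtain s where s: "is_mono C s" "S = sieve s" using assms(1) by (rule sievesE)
  obtain t where t: "is_mono C t" "T = sieve t" using assms(2) by (rule sievesE)
  have "s \<in> sieve t" using s t assms(3) mem_sieve[of s] by auto
  then obtain f where f: "f \<in> Arr C" "Dom C f = Dom C s" "Cod C f = Dom C t" "t \<cdot> f = s"
    by (rule mem_sieveE)
  obtain c where c: "is_cokernel C f c" using cokernels f by blast
  have "is_quotient S T (Cod C c)"
    unfolding is_quotient_def using s t f c by (intro exI[of _ t] exI[of _ f] exI[of _ c]) simp
  then show ?thesis by blast
qed

lemma quotient_subquotient:
  assumes "S \<in> subobjects C X" "T \<in> subobjects C X" "sieve_of S \<subseteq> sieve_of T"
  shows "is_quotient (sieve_of S) (sieve_of T) (subquotient C T S)"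
proof -
  have "subobject_le C S T" using subobject_le_iff[OF assms(1,2)] assms(3) by simp
  then obtain s t f where f: "s \<in> S" "t \<in> T" "f \<in> Hom C (Dom C s) (Dom C t)" "s = t \<cdot> f"
    by (auto simp: subobject_le_def)
  then have "f \<in> Arr C" by (simp add: Hom_def)
  then obtain c where "is_cokernel C f c" using cokernels by blast
  with f have "\<exists>Q. \<exists>s\<in>S. \<exists>t\<in>T. \<exists>f\<in>Hom C (Dom C s) (Dom C t). \<exists>c.
     s = t \<cdot> f \<and> is_cokernel C f c \<and> Q = Cod C c" by blast
  then have "\<exists>s\<in>S. \<exists>t\<in>T. \<exists>f\<in>Hom C (Dom C s) (Dom C t). \<exists>c.
     s = t \<cdot> f \<and> is_cokernel C f c \<and> subquotient C T S = Cod C c"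
    unfolding subquotient_def by (rule someI_ex)
  then obtain s t f c where *: "s \<in> S" "t \<in> T" "f \<in> Hom C (Dom C s) (Dom C t)" "s = t \<cdot> f"
    "is_cokernel C f c" "subquotient C T S = Cod C c" by blast
  have "f \<in> Arr C" "Cod C f = Dom C t" using *(3) by (auto simp: Hom_def)
  moreover note sieve_of_mem(1,2)[OF assms(1) *(1), unfolded *(4)] sieve_of_mem(1,2)[OF assms(2) *(2)]
  ultimately show ?thesis unfolding is_quotient_def using *(5,6)
    by (intro exI[of _ t] exI[of _ f] exI[of _ c]) simp
qed

text \<open>The correspondence theorem for Q = T/S, where \<open>g\<close> takes preimages. The
  equation of classes later carries slopes over.\<close>

lemma interval_iso:
  assumes Q: "is_quotient S T Q" and ST: "S \<in> sieves X" "T \<in> sieves X"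
  obtains g where "Q \<in> Obj C" "cls Q = sdiff S T"
    "\<forall>V\<in>sieves Q. g V \<in> sieves X \<and> S \<subseteq> g V \<and> g V \<subseteq> T \<and> sieve_cls (g V) = sieve_cls S \<otimes>\<^bsub>G\<^esub> sieve_cls V"
    "\<forall>V\<in>sieves Q. \<forall>V'\<in>sieves Q. g V \<subseteq> g V' \<longleftrightarrow> V \<subseteq> V'"
    "\<forall>R\<in>sieves X. S \<subseteq> R \<longrightarrow> R \<subseteq> T \<longrightarrow> (\<exists>V\<in>sieves Q. g V = R)"
proof -
  obtain t f c where t: "is_mono C t" "f \<in> Arr C" "Cod C f = Dom C t" "is_mono C (t \<cdot> f)"
    and sv: "sieve t = T" "sieve (t \<cdot> f) = S" and c: "is_cokernel C f c" and Qc: "Q = Cod C c"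
    using Q unfolding is_quotient_def by blast
  note c' = cokernelD[OF c]
  have cD: "Dom C c = Dom C t" using c' t by simp
  have "t \<in> T" using mem_sieve[of t] t sv by simp
  then have X: "Cod C t = X" using ST(2) by (auto simp: sieves_def sieve_def)
  have f: "is_mono C f"
  proof (rule monoI_null[OF t(2)])
    fix g assume g: "g \<in> Arr C" "Cod C g = Dom C f" "null (f \<cdot> g)"
    have "t \<cdot> f \<cdot> g = t \<cdot> (f \<cdot> g)" using g t by (intro comp_assoc) auto
    moreover have "null (t \<cdot> (f \<cdot> g))" by (rule null_comp(1)) (use g t in auto)
    ultimately have "null (t \<cdot> f \<cdot> g)" by simp
    then show "null g" by (rule mono_null[OF t(4)]) (use g t in auto)
  qed
  have kf: "is_kernel C c f" using kernel_of_cokernel[OF f c] .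
  \<comment> \<open>The preimage of \<open>V\<close> under the quotient arrow \<open>c\<close>,
    regarded as a set of arrows into \<open>X\<close> through \<open>t\<close>.\<close>
  define g where "g V = {t \<cdot> h | h. h \<in> Arr C \<and> Cod C h = Dom C t \<and> c \<cdot> h \<in> V}" for V
  have Q_obj: "Q \<in> Obj C" using Qc c' by simp
  \<comment> \<open>If \<open>V\<close> is the kernel of \<open>d\<close>, its preimage is the
    kernel of \<open>d \<cdot> c\<close>, hence again a subobject.\<close>
  have g_ann: "g (ann d) = sieve (t \<cdot> k)" "is_mono C (t \<cdot> k)" "Cod C (t \<cdot> k) = X"
    if d: "d \<in> Arr C" "Dom C d = Q" and k: "is_kernel C (d \<cdot> c) k" for d k
  proof -
    have dc: "d \<cdot> c \<in> Arr C" "Dom C (d \<cdot> c) = Dom C t" using d Qc c' cD by auto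
    have k': "is_mono C k" "Cod C k = Dom C t" "sieve k = ann (d \<cdot> c)" using kernelD[OF k] dc by auto
    show "is_mono C (t \<cdot> k)" "Cod C (t \<cdot> k) = X" using k' t X by (auto intro: mono_comp)
    have in_ann: "c \<cdot> h \<in> ann d \<longleftrightarrow> h \<in> sieve k" if h: "h \<in> Arr C" "Cod C h = Dom C t" for h
    proof -
      have "d \<cdot> c \<cdot> h = d \<cdot> (c \<cdot> h)" using h d Qc c' cD by (intro comp_assoc) auto
      then show ?thesis unfolding k'(3) using h d Qc c' cD dc by (simp add: ann_def)
    qed
    show "g (ann d) = sieve (t \<cdot> k)"
    proof (intro equalityI subsetI)
      fix x assume "x \<in> g (ann d)"
      then obtain h where h: "x = t \<cdot> h" "h \<in> Arr C" "Cod C h = Dom C t" "h \<in> sieve k"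
        using in_ann by (auto simp: g_def)
      obtain u where u: "u \<in> Arr C" "Dom C u = Dom C h" "Cod C u = Dom C k" "k \<cdot> u = h"
        using h(4) by (rule mem_sieveE)
      have "t \<cdot> k \<cdot> u = t \<cdot> (k \<cdot> u)" using u(1,3) k' t by (intro comp_assoc) auto
      then have "x = t \<cdot> k \<cdot> u" using h u by simp
      then show "x \<in> sieve (t \<cdot> k)" using mem_sieveI[of "t \<cdot> k" u] u(1,3) k' t(1) by simp
    next
      fix x assume "x \<in> sieve (t \<cdot> k)"
      then obtain u where u: "u \<in> Arr C" "Dom C u = Dom C x" "Cod C u = Dom C (t \<cdot> k)" "t \<cdot> k \<cdot> u = x"
        by (rule mem_sieveE)
      have uk: "Cod C u = Dom C k" using u(3) k' t(1) by simp
      have "t \<cdot> k \<cdot> u = t \<cdot> (k \<cdot> u)" using u(1) uk k' t(1) by (intro comp_assoc) auto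
      then have "x = t \<cdot> (k \<cdot> u)" using u(4) by simp
      moreover have "k \<cdot> u \<in> Arr C" "Cod C (k \<cdot> u) = Dom C t" "k \<cdot> u \<in> sieve k"
        using u(1) uk k' mem_sieveI[of k u] by auto
      ultimately show "x \<in> g (ann d)" unfolding g_def using in_ann by blast
    qed
  qed
  have 1: "g V \<in> sieves X \<and> S \<subseteq> g V \<and> g V \<subseteq> T \<and> sieve_cls (g V) = sieve_cls S \<otimes>\<^bsub>G\<^esub> sieve_cls V"
    if V: "V \<in> sieves Q" for V
  proof -
    obtain d where d: "is_epi C d" "Dom C d = Q" "V = ann d" using V by (rule sievesE)
    have dc: "is_epi C (d \<cdot> c)" "Dom C (d \<cdot> c) = Dom C t" "Cod C (d \<cdot> c) = Cod C d"
      using d Qc c' cD by (auto intro: epi_comp)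
    obtain k where k: "is_kernel C (d \<cdot> c) k" using kernels dc epi_arr by blast
    have k': "is_mono C k" "Cod C k = Dom C t" using kernelD[OF k] dc by auto
    note gV = g_ann[OF epi_arr[OF d(1)] d(2) k, folded d(3)]
    have "g V \<in> sieves X" unfolding gV(1) sieves_def using gV(2,3) by auto
    moreover have "S \<subseteq> g V"
    proof -
      have "d \<cdot> c \<cdot> f = d \<cdot> (c \<cdot> f)" using d Qc c' by (intro comp_assoc) auto
      moreover have "null (d \<cdot> (c \<cdot> f))" by (rule null_comp(1)) (use d Qc c' in auto)
      ultimately have "f \<in> sieve k" using kernelD(5)[OF k] f dc t by (simp add: ann_def)
      then obtain u where u: "u \<in> Arr C" "Dom C u = Dom C f" "Cod C u = Dom C k" "k \<cdot> u = f"
        by (rule mem_sieveE)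
      have "t \<cdot> k \<cdot> u = t \<cdot> (k \<cdot> u)" using u(1,3) k' t(1) by (intro comp_assoc) auto
      then have "t \<cdot> f = t \<cdot> k \<cdot> u" using u by simp
      then have "t \<cdot> f \<in> sieve (t \<cdot> k)" using mem_sieveI[of "t \<cdot> k" u] u(1,3) k' t(1) by simp
      then show ?thesis unfolding gV(1) sv(2)[symmetric]
        using sieve_subset_iff[OF mono_arr[OF t(4)] mono_arr[OF gV(2)]] by simp
    qed
    moreover have "g V \<subseteq> T" unfolding sv(1)[symmetric] using mem_sieveI[of t] t(1) by (auto simp: g_def)
    moreover have "sieve_cls (g V) = sieve_cls S \<otimes>\<^bsub>G\<^esub> sieve_cls V"
    proof -
      have S: "sieve_cls S = cls (Dom C f)" using sieve_cls[OF t(4)] sv(2) t(1,2,3) by simp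
      have R: "sieve_cls (g V) = cls (Dom C k)" using sieve_cls[OF gV(2)] gV(1) k' t(1) by simp
      have cl: "cls (Dom C f) \<in> carrier G" "cls (Dom C k) \<in> carrier G" "cls (Cod C d) \<in> carrier G"
        "sieve_cls V \<in> carrier G"
        using f k' d(1) sieve_cls_closed[OF V] by auto
      \<comment> \<open>Both [g V] + [Q/V] and [S] + [V] + [Q/V] equal [T]; it remains to cancel
        [Q/V], the class of the codomain of \<open>d\<close>.\<close>
      have "cls (Dom C k) \<otimes>\<^bsub>G\<^esub> cls (Cod C d) = cls (Dom C t)" using cls_epi[OF dc(1) k] dc by simp
      also have "\<dots> = cls (Dom C f) \<otimes>\<^bsub>G\<^esub> cls Q" using cls_mono[OF f c] t Qc by simp
      also have "cls Q = sieve_cls V \<otimes>\<^bsub>G\<^esub> cls (Cod C d)" using cls_ann[OF d(1)] d by simp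
      finally have "cls (Dom C k) \<otimes>\<^bsub>G\<^esub> cls (Cod C d) = cls (Dom C f) \<otimes>\<^bsub>G\<^esub> sieve_cls V \<otimes>\<^bsub>G\<^esub> cls (Cod C d)"
        using cl by (simp add: G.m_assoc)
      then show ?thesis unfolding S R using cl by (subst (asm) G.right_cancel) auto
    qed
    ultimately show ?thesis by blast
  qed
  have 2: "g V \<subseteq> g V' \<longleftrightarrow> V \<subseteq> V'" if V: "V \<in> sieves Q" "V' \<in> sieves Q" for V V'
  proof
    assume sub: "g V \<subseteq> g V'"
    obtain d where d: "is_epi C d" "Dom C d = Q" "V = ann d" using V(1) by (rule sievesE)
    obtain d' where d': "is_epi C d'" "Dom C d' = Q" "V' = ann d'" using V(2) by (rule sievesE)
    have dc: "is_epi C (d \<cdot> c)" "Dom C (d \<cdot> c) = Dom C t" "Cod C (d \<cdot> c) = Cod C d"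
      using d Qc c' cD by (auto intro: epi_comp)
    obtain k where k: "is_kernel C (d \<cdot> c) k" using kernels dc epi_arr by blast
    have k': "is_mono C k" "Cod C k = Dom C t" using kernelD[OF k] dc by auto
    \<comment> \<open>The generator of \<open>g V\<close> lies in \<open>g V'\<close>, so
      \<open>d' \<cdot> c\<close> vanishes on \<open>k\<close> and factors through
      \<open>d \<cdot> c\<close>, a cokernel of \<open>k\<close>. Cancelling \<open>c\<close> shows
      that \<open>d'\<close> factors through \<open>d\<close>.\<close>
    have "t \<cdot> k \<in> g V" unfolding d(3) g_ann(1)[OF epi_arr[OF d(1)] d(2) k]
      using k' t by (intro mem_sieve) auto
    then have "t \<cdot> k \<in> g V'" using sub by blast
    then obtain h where h: "t \<cdot> k = t \<cdot> h" "h \<in> Arr C" "Cod C h = Dom C t" "c \<cdot> h \<in> V'"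
      by (auto simp: g_def)
    have "Dom C (t \<cdot> k) = Dom C k" "Dom C (t \<cdot> h) = Dom C h" using h(2,3) k' t(1) by auto
    then have "Dom C k = Dom C h" using h(1) by simp
    then have "k = h" using mono_cancel[OF t(1) h(1)] h(2,3) k' by simp
    then have "null (d' \<cdot> (c \<cdot> k))" using h(4) d' by (simp add: ann_def)
    moreover have "d' \<cdot> c \<cdot> k = d' \<cdot> (c \<cdot> k)" using d' Qc c' cD k' by (intro comp_assoc) auto
    ultimately have "null (d' \<cdot> c \<cdot> k)" by simp
    moreover have d'c: "d' \<cdot> c \<in> Arr C" "Dom C (d' \<cdot> c) = Dom C t" "Cod C (d' \<cdot> c) = Cod C d'"
      using d' Qc c' cD by auto
    ultimately obtain w where w: "w \<in> Arr C" "Dom C w = Cod C (d \<cdot> c)" "Cod C w = Cod C (d' \<cdot> c)" "w \<cdot> (d \<cdot> c) = d' \<cdot> c"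
      using cokernel_factor[OF cokernel_of_kernel[OF dc(1) k] d'c(1)] k' by auto
    have w2: "Dom C w = Cod C d" "Cod C w = Cod C d'" using w(2,3) dc d'c by auto
    have "w \<cdot> d \<cdot> c = w \<cdot> (d \<cdot> c)" using w(1) w2 d Qc c' by (intro comp_assoc) auto
    then have "w \<cdot> d \<cdot> c = d' \<cdot> c" using w(4) by simp
    then have "w \<cdot> d = d'" by (rule epi_cancel[OF c'(2)]) (use w(1) w2 d d' Qc in auto)
    then show "V \<subseteq> V'" using ann_comp_subset[of d w] d d' w(1) w2 by simp
  qed (auto simp: g_def)
  have 3: "\<exists>V\<in>sieves Q. g V = R" if R: "R \<in> sieves X" "S \<subseteq> R" "R \<subseteq> T" for R
  proof -
    \<comment> \<open>The preimage will be the kernel of the arrow \<open>d\<close> from T/S to T/R: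
      the cokernel \<open>z\<close> of the inclusion \<open>y\<close> of R in T vanishes on S
      because \<open>S \<subseteq> R\<close>, hence equals \<open>d \<cdot> c\<close>.\<close>
    obtain r where r: "is_mono C r" "R = sieve r" using R(1) by (rule sievesE)
    have "r \<in> sieve t" using R(3) r mem_sieve[of r] sv by auto
    then obtain y where y: "y \<in> Arr C" "Dom C y = Dom C r" "Cod C y = Dom C t" "t \<cdot> y = r"
      by (rule mem_sieveE)
    have "t \<cdot> f \<in> sieve r" using R(2) r mem_sieve[of "t \<cdot> f"] t(4) sv by auto
    then obtain a where a: "a \<in> Arr C" "Dom C a = Dom C (t \<cdot> f)" "Cod C a = Dom C r" "r \<cdot> a = t \<cdot> f"
      by (rule mem_sieveE)
    have a2: "Dom C a = Dom C f" using a(2) t(1-3) by simp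
    have y_mono: "is_mono C y"
    proof (rule monoI_null[OF y(1)])
      fix g assume g: "g \<in> Arr C" "Cod C g = Dom C y" "null (y \<cdot> g)"
      have "t \<cdot> y \<cdot> g = t \<cdot> (y \<cdot> g)" using g y(1,3) t(1) by (intro comp_assoc) auto
      moreover have "null (t \<cdot> (y \<cdot> g))" by (rule null_comp(1)) (use g y(1,3) t(1) in auto)
      ultimately have "null (r \<cdot> g)" using y(4) by simp
      then show "null g" by (rule mono_null[OF r(1)]) (use g y(2) in auto)
    qed
    have "t \<cdot> y \<cdot> a = t \<cdot> (y \<cdot> a)" using y(1-3) a(1,3) t(1) by (intro comp_assoc) auto
    then have "t \<cdot> (y \<cdot> a) = t \<cdot> f" using y(4) a(4) by simp
    then have ya: "y \<cdot> a = f"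
      by (rule mono_cancel[OF t(1)]) (use y(1-3) a(1,3) a2 t(2,3) in auto)
    obtain z where z: "is_cokernel C y z" using cokernels y by blast
    note z' = cokernelD[OF z]
    have "z \<cdot> y \<cdot> a = z \<cdot> (y \<cdot> a)" using z' y(1-3) a(1,3) by (intro comp_assoc) auto
    moreover have "null (z \<cdot> y \<cdot> a)" by (rule null_comp(2)) (use z' y(1-3) a(1,3) in auto)
    ultimately have "null (z \<cdot> f)" using ya by simp
    then obtain d where d: "d \<in> Arr C" "Dom C d = Cod C c" "Cod C d = Cod C z" "d \<cdot> c = z"
      using cokernel_factor[OF c, of z] z' y(3) t(3) by auto
    have "is_kernel C (d \<cdot> c) y" using kernel_of_cokernel[OF y_mono z] d by simp
    then have "g (ann d) = R" using g_ann(1)[OF d(1)] d(2) Qc y(4) r(2) by simp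
    moreover have "ann d \<in> sieves Q" using sieves_ann[OF d(1)] d(2) Qc by simp
    ultimately show ?thesis by blast
  qed
  have "sieve_cls T = cls (Dom C t)" "sieve_cls S = cls (Dom C f)"
    using sieve_cls[OF t(1)] sieve_cls[OF t(4)] sv t(1-3) by auto
  moreover have "cls (Dom C t) = cls (Dom C f) \<otimes>\<^bsub>G\<^esub> cls Q" using cls_mono[OF f c] t(3) Qc by simp
  ultimately have cls_Q: "cls Q = sdiff S T"
    unfolding sdiff_def using Q_obj f by (simp add: G.mult_inv_cancel)
  show ?thesis by (rule that[of g, OF Q_obj cls_Q]) (use 1 in blast, use 2 in blast, use 3 in blast)
qed

end

context Grothendieck_quotient begin

section \<open>Slopes and semistability transported along the correspondence\<close>

lemma sdiff_mult_left:
  assumes "s \<in> carrier G" "v \<in> carrier G" "w \<in> carrier G"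
  shows "s \<otimes>\<^bsub>G\<^esub> w \<otimes>\<^bsub>G\<^esub> inv\<^bsub>G\<^esub> (s \<otimes>\<^bsub>G\<^esub> v) = w \<otimes>\<^bsub>G\<^esub> inv\<^bsub>G\<^esub> v"
proof -
  have "s \<otimes>\<^bsub>G\<^esub> w \<otimes>\<^bsub>G\<^esub> inv\<^bsub>G\<^esub> (s \<otimes>\<^bsub>G\<^esub> v) = s \<otimes>\<^bsub>G\<^esub> (w \<otimes>\<^bsub>G\<^esub> inv\<^bsub>G\<^esub> v) \<otimes>\<^bsub>G\<^esub> inv\<^bsub>G\<^esub> s"
    using assms by (simp add: G.inv_mult G.m_ac)
  also have "\<dots> = w \<otimes>\<^bsub>G\<^esub> inv\<^bsub>G\<^esub> v" using assms by (simp only: G.mult_inv_cancel G.m_closed G.inv_closed)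
  finally show ?thesis .
qed

lemma sdiff_add:
  assumes "S \<in> sieves X" "T \<in> sieves X" "R \<in> sieves X"
  shows "sdiff S R = sdiff S T \<otimes>\<^bsub>G\<^esub> sdiff T R"
proof -
  note c = assms[THEN sieve_cls_closed]
  have "sdiff S T \<otimes>\<^bsub>G\<^esub> sdiff T R = sieve_cls T \<otimes>\<^bsub>G\<^esub> (sieve_cls R \<otimes>\<^bsub>G\<^esub> inv\<^bsub>G\<^esub> sieve_cls S) \<otimes>\<^bsub>G\<^esub> inv\<^bsub>G\<^esub> sieve_cls T"
    unfolding sdiff_def using c by (simp add: G.m_ac)
  also have "\<dots> = sdiff S R"
    unfolding sdiff_def using c by (simp only: G.mult_inv_cancel G.m_closed G.inv_closed)
  finally show ?thesis by simp
qed

text \<open>An order isomorphism matches the ends, and the summand \<open>sieve_cls S\<close>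
  cancels in differences, so subquotients of \<open>Q\<close> and of the interval have the same
  classes.\<close>

lemma interval_iso_ends:
  assumes "is_quotient S T Q" "S \<in> sieves X" "T \<in> sieves X" "S \<subseteq> T"
  obtains g where "Q \<in> Obj C" "bij_betw g (sieves Q) {R \<in> sieves X. S \<subseteq> R \<and> R \<subseteq> T}"
    "\<forall>V\<in>sieves Q. \<forall>V'\<in>sieves Q. g V \<subset> g V' \<longleftrightarrow> V \<subset> V'"
    "\<forall>V\<in>sieves Q. sieve_cls V = sdiff S (g V)"
    "\<forall>V\<in>sieves Q. \<forall>V'\<in>sieves Q. sdiff V V' = sdiff (g V) (g V')"
    "g (bot_sieve Q) = S" "g (top_sieve Q) = T"
proof -
  obtain g where g: "Q \<in> Obj C" "cls Q = sdiff S T"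
    "\<forall>V\<in>sieves Q. g V \<in> sieves X \<and> S \<subseteq> g V \<and> g V \<subseteq> T \<and> sieve_cls (g V) = sieve_cls S \<otimes>\<^bsub>G\<^esub> sieve_cls V"
    "\<forall>V\<in>sieves Q. \<forall>V'\<in>sieves Q. g V \<subseteq> g V' \<longleftrightarrow> V \<subseteq> V'"
    "\<forall>R\<in>sieves X. S \<subseteq> R \<longrightarrow> R \<subseteq> T \<longrightarrow> (\<exists>V\<in>sieves Q. g V = R)"
    by (rule interval_iso[OF assms(1-3)])
  note g = g[rule_format]
  have inj: "inj_on g (sieves Q)"
    by (rule inj_onI) (metis g(4) order_refl subset_antisym)
  have "g ` sieves Q = {R \<in> sieves X. S \<subseteq> R \<and> R \<subseteq> T}"
    using g(3,5) by (auto simp: image_iff) metis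
  with inj have 1: "bij_betw g (sieves Q) {R \<in> sieves X. S \<subseteq> R \<and> R \<subseteq> T}"
    by (simp add: bij_betw_def)
  have 2: "g V \<subset> g V' \<longleftrightarrow> V \<subset> V'" if "V \<in> sieves Q" "V' \<in> sieves Q" for V V'
    using g(4)[OF that] g(4)[OF that(2,1)] by (simp add: less_le_not_le)
  note S = sieve_cls_closed[OF assms(2)]
  have 3: "sieve_cls V = sdiff S (g V)" if "V \<in> sieves Q" for V
    unfolding sdiff_def using g(3)[OF that] S sieve_cls_closed[OF that] by (simp add: G.mult_inv_cancel)
  have 4: "sdiff V V' = sdiff (g V) (g V')" if "V \<in> sieves Q" "V' \<in> sieves Q" for V V'
    unfolding sdiff_def using g(3)[OF that(1)] g(3)[OF that(2)] S that[THEN sieve_cls_closed]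
    by (simp add: sdiff_mult_left)
  obtain V0 V1 where V: "V0 \<in> sieves Q" "g V0 = S" "V1 \<in> sieves Q" "g V1 = T"
    using g(5)[of S] g(5)[of T] assms(2-4) by auto
  have "g (bot_sieve Q) \<subseteq> S" "T \<subseteq> g (top_sieve Q)"
    using g(4)[of "bot_sieve Q" V0] g(4)[of V1 "top_sieve Q"] V bot_sieve_mem top_sieve_mem
      bot_le_sieves sieves_le_top g(1) by auto
  moreover have "S \<subseteq> g (bot_sieve Q)" "g (top_sieve Q) \<subseteq> T"
    using g(3)[OF bot_sieve_mem[OF g(1)]] g(3)[OF top_sieve_mem[OF g(1)]] by simp_all
  ultimately have 5: "g (bot_sieve Q) = S" "g (top_sieve Q) = T" by (simp_all only: set_eq_subset)
  show ?thesis by (rule that[of g, OF g(1) 1 _ _ _ 5]) ((intro ballI, rule 2 3 4; assumption)+)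
qed

lemma cls_subquotient:
  assumes "S \<in> subobjects C X" "T \<in> subobjects C X" "sieve_of S \<subseteq> sieve_of T"
  shows "cls (subquotient C T S) = sdiff (sieve_of S) (sieve_of T)"
proof -
  have "sieve_of S \<in> sieves X" "sieve_of T \<in> sieves X"
    using assms(1,2) bij_sieve_of[of X] by (auto simp: bij_betw_def)
  then show ?thesis by (rule interval_iso[OF quotient_subquotient[OF assms]])
qed

text \<open>The seesaw inequality is given only for classes of nonzero objects. The quotient is
  nonzero because its extreme sieves correspond to the distinct sets \<open>S\<close> and
  \<open>T\<close>.\<close>

lemma sdiff_positive:
  assumes "S \<in> sieves X" "T \<in> sieves X" "S \<subset> T"
  shows "sdiff S T \<in> positive_cone C N"
proof -
  obtain Q where Q: "is_quotient S T Q" using quotient_exists assms by blast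
  obtain g where g: "Q \<in> Obj C" "bij_betw g (sieves Q) {R \<in> sieves X. S \<subseteq> R \<and> R \<subseteq> T}"
    "\<forall>V\<in>sieves Q. \<forall>V'\<in>sieves Q. g V \<subset> g V' \<longleftrightarrow> V \<subset> V'"
    "\<forall>V\<in>sieves Q. sieve_cls V = sdiff S (g V)"
    "\<forall>V\<in>sieves Q. \<forall>V'\<in>sieves Q. sdiff V V' = sdiff (g V) (g V')"
    "g (bot_sieve Q) = S" "g (top_sieve Q) = T"
    by (rule interval_iso_ends[OF Q assms(1,2) psubset_imp_subset[OF assms(3)]])
  note g = g[rule_format]
  have "\<not> is_zero_object C Q" using zero_object_iff_sieves[OF g(1)] g(6,7) assms(3) by auto
  moreover have "cls Q = sdiff S T" by (rule interval_iso[OF Q assms(1,2)])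
  ultimately show ?thesis unfolding positive_cone_def using g(1) by blast
qed

text \<open>Semistability involves subobjects only through classes, so it can be transported along
  the bijection \<open>sieve_of\<close>.\<close>

lemma semistable_iff_sieves:
  assumes "Q \<in> Obj C"
  shows "semistable C N \<tau> Q \<longleftrightarrow> bot_sieve Q \<noteq> top_sieve Q \<and>
    (\<forall>V\<in>sieves Q. V \<noteq> bot_sieve Q \<longrightarrow> V \<noteq> top_sieve Q \<longrightarrow>
      \<tau> (sieve_cls V) \<le> \<tau> (sdiff V (top_sieve Q)))"
proof -
  note bij = bij_sieve_of[of Q]
  note Z = sieve_of_zero[OF assms] and W = sieve_of_whole[OF assms]
  have 1: "S \<noteq> zero_subobject C Q \<longleftrightarrow> sieve_of S \<noteq> bot_sieve Q"
      "S \<noteq> whole_subobject C Q \<longleftrightarrow> sieve_of S \<noteq> top_sieve Q"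
      "cls (subobject_dom C S) = sieve_cls (sieve_of S)"
      "cls (subquotient C (whole_subobject C Q) S) = sdiff (sieve_of S) (top_sieve Q)"
    if S: "S \<in> subobjects C Q" for S
  proof -
    have "sieve_of S \<in> sieves Q" using S bij by (auto simp: bij_betw_def)
    then have "sieve_of S \<subseteq> sieve_of (whole_subobject C Q)" using sieves_le_top[OF assms] W by simp
    then show "cls (subquotient C (whole_subobject C Q) S) = sdiff (sieve_of S) (top_sieve Q)"
      using cls_subquotient[OF S] W by simp
    show "S \<noteq> zero_subobject C Q \<longleftrightarrow> sieve_of S \<noteq> bot_sieve Q"
      "S \<noteq> whole_subobject C Q \<longleftrightarrow> sieve_of S \<noteq> top_sieve Q"
      using bij_betw_imp_inj_on[OF bij] S Z W by (metis inj_onD)+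
  qed (rule cls_subobject_dom[OF S])
  let ?P = "\<lambda>V. V \<noteq> bot_sieve Q \<longrightarrow> V \<noteq> top_sieve Q \<longrightarrow>
      \<tau> (sieve_cls V) \<le> \<tau> (sdiff V (top_sieve Q))"
  have "(\<forall>S\<in>subobjects C Q. S \<noteq> zero_subobject C Q \<and> S \<noteq> whole_subobject C Q \<longrightarrow>
      \<tau> (cls (subobject_dom C S)) \<le> \<tau> (cls (subquotient C (whole_subobject C Q) S))) \<longleftrightarrow>
    (\<forall>S\<in>subobjects C Q. ?P (sieve_of S))"
    by (intro ball_cong refl) (simp only: 1 imp_conjL)
  also have "\<dots> \<longleftrightarrow> (\<forall>V\<in>sieve_of ` subobjects C Q. ?P V)" by simp
  finally show ?thesis
    unfolding semistable_def zero_object_iff_sieves[OF assms] bij_betw_imp_surj_on[OF bij]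
    using assms by simp
qed

lemma semistable_quotient_iff:
  assumes "is_quotient S T Q" "S \<in> sieves X" "T \<in> sieves X" "S \<subseteq> T"
  shows "semistable C N \<tau> Q \<longleftrightarrow> S \<subset> T \<and>
    (\<forall>R\<in>sieves X. S \<subset> R \<longrightarrow> R \<subset> T \<longrightarrow> \<tau> (sdiff S R) \<le> \<tau> (sdiff R T))"
proof -
  obtain g where g: "Q \<in> Obj C" "bij_betw g (sieves Q) {R \<in> sieves X. S \<subseteq> R \<and> R \<subseteq> T}"
    "\<forall>V\<in>sieves Q. \<forall>V'\<in>sieves Q. g V \<subset> g V' \<longleftrightarrow> V \<subset> V'"
    "\<forall>V\<in>sieves Q. sieve_cls V = sdiff S (g V)"
    "\<forall>V\<in>sieves Q. \<forall>V'\<in>sieves Q. sdiff V V' = sdiff (g V) (g V')"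
    "g (bot_sieve Q) = S" "g (top_sieve Q) = T"
    by (rule interval_iso_ends[OF assms])
  note g = g[rule_format]
  note inj = inj_on_eq_iff[OF bij_betw_imp_inj_on[OF g(2)]]
  have top: "top_sieve Q \<in> sieves Q" and bot: "bot_sieve Q \<in> sieves Q"
    using top_sieve_mem bot_sieve_mem g(1) by auto
  have "(\<forall>V\<in>sieves Q. V \<noteq> bot_sieve Q \<longrightarrow> V \<noteq> top_sieve Q \<longrightarrow>
      \<tau> (sieve_cls V) \<le> \<tau> (sdiff V (top_sieve Q))) \<longleftrightarrow>
    (\<forall>V\<in>sieves Q. g V \<noteq> S \<longrightarrow> g V \<noteq> T \<longrightarrow> \<tau> (sdiff S (g V)) \<le> \<tau> (sdiff (g V) T))"
    using inj[OF _ bot] inj[OF _ top] g(4) g(5)[OF _ top] by (intro ball_cong refl) (simp add: g(6,7))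
  also have "\<dots> \<longleftrightarrow> (\<forall>R\<in>g ` sieves Q. R \<noteq> S \<longrightarrow> R \<noteq> T \<longrightarrow> \<tau> (sdiff S R) \<le> \<tau> (sdiff R T))"
    by simp
  \<comment> \<open>Within the interval, differing from both ends means lying strictly between
    them.\<close>
  also have "\<dots> \<longleftrightarrow> (\<forall>R\<in>sieves X. S \<subset> R \<longrightarrow> R \<subset> T \<longrightarrow> \<tau> (sdiff S R) \<le> \<tau> (sdiff R T))"
    unfolding bij_betw_imp_surj_on[OF g(2)] by (simp add: psubset_eq) blast
  finally show ?thesis
    using semistable_iff_sieves[OF g(1)] inj[OF bot top] assms(4) g(6,7) by (auto simp: psubset_eq)
qed

lemma chain_of_sieves:
  fixes V :: "nat \<Rightarrow> _"
  assumes "\<forall>n. V n \<in> sieves X"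
  shows "\<exists>B. \<forall>n. B n \<in> subobjects C X \<and> sieve_of (B n) = V n"
proof (rule choice, rule allI)
  fix n
  have "V n \<in> sieve_of ` subobjects C X"
    using assms by (simp add: bij_betw_imp_surj_on[OF bij_sieve_of])
  then show "\<exists>S. S \<in> subobjects C X \<and> sieve_of S = V n" by auto
qed

end

section \<open>The Harder-Narasimhan filtration\<close>

locale stable_category = Grothendieck_quotient +
  fixes \<tau> :: "_ \<Rightarrow> 't::linorder"
  assumes weak: "weak_stability_condition C N \<tau>"
    and noeth: "noetherian_category C"
    and artin: "artinian_wrt C N \<tau>"
begin

lemma slope_lattice_sieves:
  assumes X: "X \<in> Obj C"
  shows "slope_lattice (sieves X) (top_sieve X) (\<lambda>S T. \<tau> (sdiff S T))"
proof
  show "top_sieve X \<in> sieves X" using top_sieve_mem X .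
  show "S \<subseteq> top_sieve X" if "S \<in> sieves X" for S using sieves_le_top X that .
  show "S \<inter> T \<in> sieves X" if "S \<in> sieves X" "T \<in> sieves X" for S T
    using sieves_Int_join(1) that .
  show "\<exists>J\<in>sieves X. S \<subseteq> J \<and> T \<subseteq> J \<and> (\<forall>R\<in>sieves X. S \<subseteq> R \<longrightarrow> T \<subseteq> R \<longrightarrow> J \<subseteq> R) \<and>
      \<tau> (sdiff (S \<inter> T) S) = \<tau> (sdiff T J)" if "S \<in> sieves X" "T \<in> sieves X" for S T
    using sieves_Int_join(2)[OF that] by metis
  show "\<tau> (sdiff S T) \<le> \<tau> (sdiff S R) \<and> \<tau> (sdiff S R) \<le> \<tau> (sdiff T R) \<or>
      \<tau> (sdiff S R) \<le> \<tau> (sdiff S T) \<and> \<tau> (sdiff T R) \<le> \<tau> (sdiff S R)"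
    if "S \<in> sieves X" "T \<in> sieves X" "R \<in> sieves X" "S \<subset> T" "T \<subset> R" for S T R
  proof -
    have "sdiff S T \<in> positive_cone C N" "sdiff S R \<in> positive_cone C N" "sdiff T R \<in> positive_cone C N"
      using that by (auto intro!: sdiff_positive)
    then show ?thesis using weak sdiff_add[OF that(1-3)] unfolding weak_stability_condition_def by blast
  qed
  show False if A: "\<And>n. A n \<in> sieves X" "\<And>n. A n \<subset> A (Suc n)" for A :: "nat \<Rightarrow> _"
  proof -
    obtain B where B: "\<And>n. B n \<in> subobjects C X" "\<And>n. sieve_of (B n) = A n"
      using chain_of_sieves[of A X] A(1) by auto
    then have "\<forall>n. B n \<in> subobjects C X \<and> subobject_le C (B n) (B (Suc n))"
      using subobject_le_iff A(2) by (metis psubset_imp_subset)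
    then obtain n where "\<forall>m\<ge>n. B m = B n" using noeth X unfolding noetherian_category_def by meson
    from this[rule_format, of "Suc n"] have "B (Suc n) = B n" by simp
    then have "A (Suc n) = A n" using B(2) by metis
    then show False using A(2)[of n] by simp
  qed
  show False if U: "U \<in> sieves X" and A: "\<And>n. A n \<in> sieves X" "\<And>n. U \<subset> A n" "\<And>n. A (Suc n) \<subset> A n"
    "\<And>n. \<tau> (sdiff (A (Suc n)) (A n)) \<le> \<tau> (sdiff U (A (Suc n)))" for U and A :: "nat \<Rightarrow> _"
  proof -
    note UX = U top_sieve_mem[OF X] sieves_le_top[OF X U]
    \<comment> \<open>\<open>Q\<close> is X/U. The chain above \<open>U\<close> corresponds to a
      chain of subobjects of \<open>Q\<close> with the same classes, which
      \<open>artinian_wrt\<close> excludes.\<close>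
    obtain Q where Q: "is_quotient U (top_sieve X) Q" using quotient_exists[OF UX] by blast
    obtain g where g: "Q \<in> Obj C" "bij_betw g (sieves Q) {R \<in> sieves X. U \<subseteq> R \<and> R \<subseteq> top_sieve X}"
      "\<forall>V\<in>sieves Q. \<forall>V'\<in>sieves Q. g V \<subset> g V' \<longleftrightarrow> V \<subset> V'"
      "\<forall>V\<in>sieves Q. sieve_cls V = sdiff U (g V)"
      "\<forall>V\<in>sieves Q. \<forall>V'\<in>sieves Q. sdiff V V' = sdiff (g V) (g V')"
      "g (bot_sieve Q) = U" "g (top_sieve Q) = top_sieve X"
      by (rule interval_iso_ends[OF Q UX])
    note g = g[rule_format]
    have "\<forall>n. \<exists>V. V \<in> sieves Q \<and> g V = A n"
    proof
      fix n
      have "A n \<in> {R \<in> sieves X. U \<subseteq> R \<and> R \<subseteq> top_sieve X}"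
        using A(1,2)[of n] sieves_le_top[OF X] by auto
      then have "A n \<in> g ` sieves Q" by (simp only: bij_betw_imp_surj_on[OF g(2)])
      then show "\<exists>V. V \<in> sieves Q \<and> g V = A n" by blast
    qed
    then obtain V where V: "\<And>n. V n \<in> sieves Q" "\<And>n. g (V n) = A n" by metis
    obtain B where B: "\<And>n. B n \<in> subobjects C Q" "\<And>n. sieve_of (B n) = V n"
      using chain_of_sieves[of V Q] V(1) by auto
    have sub: "V (Suc n) \<subset> V n" for n using g(3)[OF V(1) V(1)] V(2) A(3) by simp
    have "subobject_le C (B (Suc n)) (B n) \<and> B (Suc n) \<noteq> B n \<and>
        \<tau> (cls (subquotient C (B n) (B (Suc n)))) \<le> \<tau> (cls (subobject_dom C (B (Suc n))))" for n
    proof (intro conjI)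
      have le: "sieve_of (B (Suc n)) \<subseteq> sieve_of (B n)" using sub[of n] B(2) by auto
      then show "subobject_le C (B (Suc n)) (B n)" using subobject_le_iff[OF B(1) B(1)] by simp
      show "B (Suc n) \<noteq> B n" using sub[of n] B(2)[of n] B(2)[of "Suc n"] by auto
      have "cls (subquotient C (B n) (B (Suc n))) = sdiff (A (Suc n)) (A n)"
        using cls_subquotient[OF B(1) B(1) le] B(2) g(5)[OF V(1) V(1)] V(2) by simp
      moreover have "cls (subobject_dom C (B (Suc n))) = sdiff U (A (Suc n))"
        using cls_subobject_dom[OF B(1)] B(2) g(4)[OF V(1)] V(2) by simp
      ultimately show "\<tau> (cls (subquotient C (B n) (B (Suc n)))) \<le> \<tau> (cls (subobject_dom C (B (Suc n))))"
        using A(4) by simp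
    qed
    then show False using artin g(1) B(1) unfolding artinian_wrt_def by blast
  qed
qed

theorem ex1_HN_filtration:
  assumes X: "X \<in> Obj C"
  shows "\<exists>!A. HN_filtration C N \<tau> X A"
proof -
  interpret slope_lattice "sieves X" "top_sieve X" "\<lambda>S T. \<tau> (sdiff S T)"
    by (rule slope_lattice_sieves[OF X])
  note bij = bij_sieve_of[of X]
  note inj = inj_on_eq_iff[OF bij_betw_imp_inj_on[OF bij]]
  note Z = sieve_of_zero[OF X] and W = sieve_of_whole[OF X]
  have iff: "HN_filtration C N \<tau> X A \<longleftrightarrow> hn_chain (bot_sieve X) (map sieve_of A)"
    if A: "set A \<subseteq> subobjects C X" for A
  proof -
    \<comment> \<open>Inclusion and semistability are translated together, because it is the nonzero
      factor that makes the inclusion strict.\<close>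
    have factor: "subobject_le C S T \<and> semistable C N \<tau> (subquotient C T S) \<longleftrightarrow>
        sieve_of S \<subset> sieve_of T \<and> sst (sieve_of S) (sieve_of T)"
      "subobject_le C S T \<Longrightarrow> cls (subquotient C T S) = sdiff (sieve_of S) (sieve_of T)"
      if ST: "S \<in> subobjects C X" "T \<in> subobjects C X" for S T
    proof -
      have "sieve_of S \<in> sieves X" "sieve_of T \<in> sieves X"
        using ST bij by (auto simp: bij_betw_def)
      then show "subobject_le C S T \<and> semistable C N \<tau> (subquotient C T S) \<longleftrightarrow>
          sieve_of S \<subset> sieve_of T \<and> sst (sieve_of S) (sieve_of T)"
        using semistable_quotient_iff[OF quotient_subquotient[OF ST]] subobject_le_iff[OF ST]
        unfolding sst_def by (metis psubset_imp_subset)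
      show "cls (subquotient C T S) = sdiff (sieve_of S) (sieve_of T)" if "subobject_le C S T"
        using cls_subquotient[OF ST] subobject_le_iff[OF ST] that by simp
    qed
    show ?thesis
    proof (cases "A = []")
      \<comment> \<open>Both sides are false, since a filtration has at least one term.\<close>
      case True
      then show ?thesis by (simp add: HN_filtration_def hn_chain_def)
    next
      case False
      define n where "n = length A - 1"
      have n: "length A = n + 1" using False by (simp add: n_def Suc_leI)
      have mem: "A ! k \<in> subobjects C X" if "k \<le> n" for k
        using A nth_mem[of k A] that n by auto
      have nth: "map sieve_of A ! k = sieve_of (A ! k)" if "k \<le> n" for k
        using that n by simp
      have ends: "A ! 0 = zero_subobject C X \<longleftrightarrow> map sieve_of A ! 0 = bot_sieve X"
        "A ! n = whole_subobject C X \<longleftrightarrow> map sieve_of A ! n = top_sieve X"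
        using inj[OF mem, of 0 "zero_subobject C X"] inj[OF mem, of n "whole_subobject C X"] Z W n by auto
      have steps: "(\<forall>k\<in>{1..n}. subobject_le C (A ! (k - 1)) (A ! k)) \<and>
          (\<forall>k\<in>{1..n}. semistable C N \<tau> (filtration_factor C A k)) \<longleftrightarrow>
        (\<forall>k\<in>{1..n}. map sieve_of A ! (k - 1) \<subset> map sieve_of A ! k \<and>
          sst (map sieve_of A ! (k - 1)) (map sieve_of A ! k))"
      proof -
        have "subobject_le C (A ! (k - 1)) (A ! k) \<and> semistable C N \<tau> (filtration_factor C A k) \<longleftrightarrow>
          map sieve_of A ! (k - 1) \<subset> map sieve_of A ! k \<and>
          sst (map sieve_of A ! (k - 1)) (map sieve_of A ! k)" if "k \<in> {1..n}" for k
        proof -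
          have k: "k - 1 \<le> n" "k \<le> n" using that by auto
          show ?thesis unfolding filtration_factor_def nth[OF k(1)] nth[OF k(2)]
            by (rule factor(1)[OF mem[OF k(1)] mem[OF k(2)]])
        qed
        then show ?thesis by blast
      qed
      \<comment> \<open>The inclusions are assumed because \<open>factor(2)\<close> computes the
        class of a \<open>subquotient\<close> only for them; either side of the equivalence to be
        shown supplies them.\<close>
      have slopes: "(\<forall>k\<in>{1..<n}. \<tau> (cls (filtration_factor C A (k + 1))) < \<tau> (cls (filtration_factor C A k))) \<longleftrightarrow>
        (\<forall>k\<in>{1..<n}. \<tau> (sdiff (map sieve_of A ! k) (map sieve_of A ! (k + 1))) <
           \<tau> (sdiff (map sieve_of A ! (k - 1)) (map sieve_of A ! k)))"
        if le: "\<forall>k\<in>{1..n}. subobject_le C (A ! (k - 1)) (A ! k)"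
      proof (intro ball_cong refl)
        fix k assume k: "k \<in> {1..<n}"
        have "cls (filtration_factor C A j) = sdiff (map sieve_of A ! (j - 1)) (map sieve_of A ! j)"
          if "j \<in> {1..n}" for j
        proof -
          have j: "j - 1 \<le> n" "j \<le> n" using that by auto
          show ?thesis unfolding filtration_factor_def nth[OF j(1)] nth[OF j(2)]
            by (rule factor(2)[OF mem[OF j(1)] mem[OF j(2)]]) (use le that in blast)
        qed
        from this[of k] this[of "k + 1"]
        show "\<tau> (cls (filtration_factor C A (k + 1))) < \<tau> (cls (filtration_factor C A k)) \<longleftrightarrow>
          \<tau> (sdiff (map sieve_of A ! k) (map sieve_of A ! (k + 1))) <
           \<tau> (sdiff (map sieve_of A ! (k - 1)) (map sieve_of A ! k))" using k by simp
      qed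
      have sub: "set (map sieve_of A) \<subseteq> sieves X" using A bij by (auto simp: bij_betw_def)
      have len: "(\<exists>m. length A = m + 1 \<and> P m) \<longleftrightarrow> P n" for P using n by auto
      show ?thesis unfolding HN_filtration_def hn_chain_def length_map len
        using A sub ends steps slopes by blast
    qed
  qed
  obtain B where B: "hn_chain (bot_sieve X) B" "\<And>B'. hn_chain (bot_sieve X) B' \<Longrightarrow> B' = B"
    using ex1_hn_chain[OF bot_sieve_mem[OF X]] by blast
  \<comment> \<open>The unique chain of sieves is lifted entry by entry along the bijection;
    injectivity of \<open>sieve_of\<close> makes the lift unique.\<close>
  have "set B \<subseteq> sieve_of ` subobjects C X"
    using B(1) bij_betw_imp_surj_on[OF bij] by (auto simp: hn_chain_def)
  then have "B \<in> map sieve_of ` lists (subobjects C X)"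
    unfolding lists_image[symmetric] by (simp add: in_lists_conv_set subset_iff)
  then obtain A where A: "set A \<subseteq> subobjects C X" "B = map sieve_of A" by auto
  show ?thesis
  proof (rule ex1I[of _ A])
    show "HN_filtration C N \<tau> X A" using iff A B(1) by simp
    fix A' assume A': "HN_filtration C N \<tau> X A'"
    then have sub: "set A' \<subseteq> subobjects C X" by (auto simp: HN_filtration_def)
    then have "map sieve_of A' = map sieve_of A" using iff A' B(2) A(2) by simp
    moreover have "inj_on sieve_of (set A' \<union> set A)"
      by (rule inj_on_subset[OF bij_betw_imp_inj_on[OF bij]]) (use sub A(1) in simp)
    ultimately show "A' = A" by (simp add: inj_on_map_eq_map)
  qed
qed

end

theorem theorem4p4:
  fixes C :: "('o, 'm, 'z) add_cat_scheme"
    and N :: "('o \<Rightarrow>\<^sub>0 int) set set"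
    and \<tau> :: "('o \<Rightarrow>\<^sub>0 int) set set \<Rightarrow> 't::linorder"
  assumes "abelian_category C"
    and "subgroup N (K0 C)"
    and "\<And>X. X \<in> Obj C \<Longrightarrow> K_class C N X = \<one>\<^bsub>K_group C N\<^esub> \<Longrightarrow> is_zero_object C X"
    and "weak_stability_condition C N \<tau>"
    and "noetherian_category C"
    and "artinian_wrt C N \<tau>"
    and "X \<in> Obj C"
  shows "\<exists>!A. HN_filtration C N \<tau> X A"
proof -
  interpret stable_category C N \<tau>
    using assms(1,2,4-6)
    by (auto simp: stable_category_def stable_category_axioms_def Grothendieck_quotient_def
        Grothendieck_quotient_axioms_def)
  show ?thesis by (rule ex1_HN_filtration[OF assms(7)])
qed

end
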